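(* Let $d\ge1$, $s\in(0,1)$, $N\in\mathbb{N}$, $h=\frac{2\pi}{2N+1}$, and let $v:A_{h,d}^N\to\mathbb{R}$ (i.e. $v\in\ell_s(A_{h,d}^N)$). Then $$(-\Delta_{A_{h,d}^N})^s v_j=\sum_{\substack{m\in\{-N,\dots,N\}^d\\ m\ne j}}(v_j-v_m)K_s^{A_{h,d}^N}(j-m),\qquad j\in\{-N,\dots,N\}^d,$$ where, for $j\in\mathbb{Z}^d\setminus(2N+1)\mathbb{Z}^d$, $$K_s^{A_{h,d}^N}(j)=\sum_{k\in\mathbb{Z}^d}K_s^h\big(j+k(2N+1)\big).$$ In particular, for $d=1$, writing $A_h^N=A_{h,1}^N$, $$(-\Delta_{A_{h}^N})^s v_j=\sum_{\substack{m\in\{-N,\dots,N\}\\ m\ne j}}(v_j-v_m)K_s^{A_{h}^N}(j-m),\qquad j\in\{-N,\dots,N\},$$ where, for $j\in\mathbb{Z}\setminus(2N+1)\mathbb{Z}$, $$K_s^{A_h^N}(j)=\frac{4^s\Gamma(1/2+s)}{h^{2s}\sqrt\pi\,|\Gamma(-s)|}\sum_{k=-\infty}^\infty\frac{\Gamma(|j+k(2N+1)|-s)}{\Gamma(|j+k(2N+1)|+1+s)}.$$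
   Context: The discrete torus is $A_{h,d}^N=(h\{-N,\dots,N\})^d$, regarded as the group $(h\mathbb{Z}_{2N+1})^d$, and $v_j:=v(hj)$. The fractional Laplacian on $A_{h,d}^N$ is defined by $$(-\Delta_{A_{h,d}^N})^s v_j=\sum_{k\in\{-N,\dots,N\}^d}\Big(\sum_{i=1}^d\frac4{h^2}\sin^2\Big(\frac{k_i\pi}{2N+1}\Big)\Big)^s c_k(v)\,e^{ik\cdot\frac{2\pi j}{2N+1}},\qquad c_k(v)=\frac1{(2N+1)^d}\sum_{j\in\{-N,\dots,N\}^d}v_je^{-2\pi i k\cdot\frac{j}{2N+1}}.$$ The kernel of the fractional discrete Laplacian on $(h\mathbb{Z})^d$ is $K_s^h(m)=\frac{1}{h^{2s}|\Gamma(-s)|}\int_0^\infty e^{-2dt}\prod_{i=1}^dI_{m_i}(2t)\frac{dt}{t^{1+s}}$ for $m\in\mathbb{Z}^d\setminus\{0\}$, where $I_k$ is the modified Bessel function of the first kind of order $k\in\mathbb{Z}$ (so $I_{-k}=I_k$). *)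

theory Defs
  imports "HOL-Analysis.Analysis"
begin

text \<open>
  Modified Bessel function of the first kind of integer order, by its standard power series
  \<open>(x/2)\<^sup>k \<Sum> (x/2)\<^sup>2\<^sup>n / (n! \<Gamma>(n+k+1))\<close>. As \<open>rGamma\<close> (the reciprocal Gamma function) vanishes at
  nonpositive integers, this also covers negative orders.
\<close>

definition bessel_I :: "int \<Rightarrow> real \<Rightarrow> real" where
  "bessel_I k x =
     (\<Sum>n. rGamma (real n + real_of_int k + 1) / fact n * (x / 2) powi (2 * int n + k))"

lemma bessel_I_of_nat:
  "bessel_I (int k) x = (\<Sum>n. (x / 2) ^ (2 * n + k) / (fact n * fact (n + k)))"
proof -
  have "rGamma (real n + real_of_int (int k) + 1) / fact n * (x / 2) powi (2 * int n + int k)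
      = (x / 2) ^ (2 * n + k) / (fact n * fact (n + k))" for n
  proof -
    have "rGamma (real n + real_of_int (int k) + 1) = inverse (Gamma (1 + real (n + k)))"
      by (simp add: rGamma_inverse_Gamma algebra_simps)
    also have "\<dots> = inverse (fact (n + k))"
      by (simp only: Gamma_fact)
    finally have 1: "rGamma (real n + real_of_int (int k) + 1) = inverse (fact (n + k))" .
    have "2 * int n + int k = int (2 * n + k)" by simp
    then have 2: "(x / 2) powi (2 * int n + int k) = (x / 2) ^ (2 * n + k)"
      by (simp only: power_int_of_nat)
    show ?thesis unfolding 1 2 by (simp add: field_simps)
  qed
  then show ?thesis by (simp add: bessel_I_def)
qed

lemma bessel_I_minus: "bessel_I (- k) x = bessel_I k x"
proof -
  define f where "f k n = rGamma (real n + real_of_int k + 1) / fact n * (x / 2) powi (2 * int n + k)"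
    for k :: int and n
  have shift: "f (- int k) (n + k) = f (int k) n" for k n
  proof -
    have a: "rGamma (real (n + k) + real_of_int (- int k) + 1) = inverse (fact n)"
    proof -
      have "real (n + k) + real_of_int (- int k) + 1 = 1 + real n" by simp
      then show ?thesis by (simp only: rGamma_inverse_Gamma Gamma_fact)
    qed
    have b: "rGamma (real n + real_of_int (int k) + 1) = inverse (fact (n + k))"
    proof -
      have "real n + real_of_int (int k) + 1 = 1 + real (n + k)" by simp
      then show ?thesis by (simp only: rGamma_inverse_Gamma Gamma_fact)
    qed
    have c: "2 * int (n + k) + - int k = 2 * int n + int k" by simp
    show ?thesis unfolding f_def a b c by (simp add: field_simps)
  qed
  have zero: "f (- int k) n = 0" if "n < k" for k n
  proof -
    have "real n + real_of_int (- int k) + 1 = of_int (int n - int k + 1)" by simp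
    moreover have "of_int (int n - int k + 1) \<in> (\<int>\<^sub>\<le>\<^sub>0 :: real set)"
      using that by (subst of_int_in_nonpos_Ints_iff) auto
    ultimately have "rGamma (real n + real_of_int (- int k) + 1) = 0"
      by (simp only: rGamma_eq_zero_iff)
    then show ?thesis by (simp add: f_def)
  qed
  have nat: "suminf (f (- int k)) = suminf (f (int k))" for k
  proof -
    have "(f (int k) sums S) \<longleftrightarrow> (f (- int k) sums S)" for S
      using sums_iff_shift[of "f (- int k)" k S] by (simp add: shift zero)
    then show ?thesis by (simp add: suminf_def)
  qed
  have B: "bessel_I k x = suminf (f k)" for k
    unfolding bessel_I_def f_def ..
  show ?thesis
    by (cases k rule: int_cases2) (simp_all add: B nat)
qed

text \<open>Points \<open>h j\<close> of the discrete torus are addressed by their indices \<open>j \<in> {-N..N}\<^sup>d\<close>.\<close>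

definition index_cube :: "nat \<Rightarrow> (int ^ 'd) set" where
  "index_cube N = {j. \<forall>i. j $ i \<in> {- int N..int N}}"

definition grid_val :: "real \<Rightarrow> (real ^ 'd \<Rightarrow> real) \<Rightarrow> int ^ 'd \<Rightarrow> real" where
  "grid_val h v j = v (\<chi> i. h * real_of_int (j $ i))"

definition idot :: "int ^ 'd \<Rightarrow> int ^ 'd \<Rightarrow> int" where
  "idot k j = (\<Sum>i\<in>UNIV. k $ i * j $ i)"

definition fourier_coeff :: "nat \<Rightarrow> real \<Rightarrow> (real ^ 'd \<Rightarrow> real) \<Rightarrow> int ^ 'd \<Rightarrow> complex" where
  "fourier_coeff N h v k =
     1 / (2 * of_nat N + 1) ^ CARD('d) *
     (\<Sum>j\<in>index_cube N. of_real (grid_val h v j) *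
        exp (- 2 * of_real pi * \<i> * of_int (idot k j) / (2 * of_nat N + 1)))"

definition torus_frac_laplacian ::
    "nat \<Rightarrow> real \<Rightarrow> real \<Rightarrow> (real ^ 'd \<Rightarrow> real) \<Rightarrow> int ^ 'd \<Rightarrow> complex" where
  "torus_frac_laplacian N h s v j =
     (\<Sum>k\<in>index_cube N.
        of_real ((\<Sum>i\<in>UNIV. 4 / h\<^sup>2 * (sin (real_of_int (k $ i) * pi / (2 * real N + 1)))\<^sup>2) powr s) *
        fourier_coeff N h v k *
        exp (\<i> * of_int (idot k j) * (2 * of_real pi) / (2 * of_nat N + 1)))"

definition lattice_kernel :: "real \<Rightarrow> real \<Rightarrow> int ^ 'd \<Rightarrow> real" where
  "lattice_kernel h s m =
     1 / (h powr (2 * s) * \<bar>Gamma (- s)\<bar>) *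
     (LINT t:{0<..}|lborel.
        exp (- 2 * real CARD('d) * t) * (\<Prod>i\<in>UNIV. bessel_I (m $ i) (2 * t)) / t powr (1 + s))"

definition torus_kernel :: "nat \<Rightarrow> real \<Rightarrow> real \<Rightarrow> int ^ 'd \<Rightarrow> real" where
  "torus_kernel N h s j = (\<Sum>\<^sub>\<infinity>k\<in>UNIV. lattice_kernel h s (j + (2 * int N + 1) *s k))"

end

theory Submission
  imports Defs
begin

text \<open>
  Both Laplacians generate heat semigroups, and fractional powers of a generator are
  integrals over its semigroup: for \<open>\<lambda> \<ge> 0\<close>,
  \<open>\<bar>\<Gamma>(-s)\<bar> \<lambda>\<^sup>s = \<integral>\<^sub>0\<^sup>\<infinity> (1 - e\<^sup>-\<^sup>t\<^sup>\<lambda>) t\<^sup>-\<^sup>1\<^sup>-\<^sup>s dt\<close> (\<open>nn_integral_frac_power\<close>). It therefore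
  suffices to relate the two heat kernels, and there the relation is that of a covering:
  with \<open>M = 2N + 1\<close>, the heat kernel of the torus is the sum of the heat kernel of the lattice over the
  \<open>M\<close>-periodic translates.

  On the lattice the heat kernel is \<open>e\<^sup>-\<^sup>2\<^sup>d\<^sup>t \<Prod> I(n\<^sub>i, 2t)\<close>, on the torus it is
  \<open>M\<^sup>-\<^sup>d \<Sum>\<^sub>k e\<^sup>-\<^sup>t\<^sup>\<lambda>\<^sup>(\<^sup>k\<^sup>) \<chi>(k \<bullet> n)\<close> with \<open>\<chi>(n) = e\<^bsup>2\<pi>in/M\<^esup>\<close>. Both factor over the coordinates. In one
  coordinate the generating function \<open>\<Sum>\<^sub>m I(m, 2t) z\<^sup>m = exp (t (z + 1/z))\<close>, evaluated at the \<open>M\<close>-th roots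
  of unity, turns into the periodization by orthogonality of the characters
  (\<open>circle_heat_kernel_periodization\<close>, \<open>torus_heat_kernel_periodization\<close>).

  By its definition the fractional Laplacian on the torus is convolution with
  \<open>W(n) = M\<^sup>-\<^sup>d \<Sum>\<^sub>k \<lambda>(k)\<^sup>s \<chi>(k \<bullet> n)\<close> (up to the factor \<open>h\<^sup>-\<^sup>2\<^sup>s\<close>), and \<open>W\<close> has total mass zero because
  \<open>\<lambda>(0) = 0\<close>; this gives the form \<open>\<Sum> (v\<^sub>j - v\<^sub>m) (-W(j - m))\<close>. Away from the lattice \<open>M\<int>\<^sup>d\<close> the constant
  \<open>1\<close> in \<open>1 - e\<^sup>-\<^sup>t\<^sup>\<lambda>\<close> cancels after summing over the characters, so \<open>-\<bar>\<Gamma>(-s)\<bar> W(n)\<close> is the integral of the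
  torus heat kernel against \<open>t\<^sup>-\<^sup>1\<^sup>-\<^sup>s\<close>. Monotone convergence exchanges this integral with the
  periodization sum, whose terms are all nonnegative, and yields convergence and the value of the
  kernel series at once (\<open>lattice_kernel_has_sum\<close>).

  In dimension one the lattice kernel is computed from the Poisson integral
  \<open>e\<^sup>-\<^sup>2\<^sup>t I(m, 2t) = c t\<^sup>m \<integral>\<^sub>0\<^sup>1 (w (1 - w))\<^bsup>m - 1/2\<^esup> e\<^bsup>-4tw\<^esup> dw\<close>: after exchanging the integrals the
  \<open>t\<close>-integral is a Gamma integral and the remaining \<open>w\<close>-integral is a Beta integral
  (\<open>nn_integral_bessel_I_frac\<close>).
\<close>

section \<open>The generating function of the modified Bessel functions\<close>

lemma exp_has_sum: "((\<lambda>n. z ^ n / fact n) has_sum exp z) UNIV" for z :: complex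
proof (rule norm_summable_imp_has_sum)
  show "summable (\<lambda>n. norm (z ^ n / fact n))"
    using summable_norm_exp[of z] by (simp add: divide_inverse_commute scaleR_conv_of_real norm_mult norm_power norm_inverse)
  show "(\<lambda>n. z ^ n / fact n) sums exp z"
    using exp_converges[of z] by (simp add: scaleR_conv_of_real divide_inverse_commute)
qed

lemma exp_times_exp_has_sum:
  fixes x y :: complex
  shows "((\<lambda>(a, b). x ^ a / fact a * (y ^ b / fact b)) has_sum exp x * exp y) (UNIV \<times> UNIV)"
proof (rule has_sum_SigmaI)
  have abs: "(\<lambda>n. norm (z ^ n / fact n)) summable_on UNIV" for z :: complex
    using summable_norm_exp[of z]
    by (intro norm_summable_imp_summable_on)
       (simp add: divide_inverse_commute scaleR_conv_of_real norm_mult norm_power norm_inverse)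
  have "(\<lambda>(a, b). norm (x ^ a / fact a) * norm (y ^ b / fact b)) summable_on UNIV \<times> UNIV"
  proof (rule summable_on_SigmaI)
    show "((\<lambda>b. case (a, b) of (a, b) \<Rightarrow> norm (x ^ a / fact a) * norm (y ^ b / fact b)) has_sum
        norm (x ^ a / fact a) * (\<Sum>\<^sub>\<infinity>b. norm (y ^ b / fact b))) UNIV" for a
      using has_sum_cmult_right[OF has_sum_infsum[OF abs[of y]]] by simp
  qed (use summable_on_cmult_left[OF abs] in auto)
  then have "(\<lambda>p. norm (case p of (a, b) \<Rightarrow> x ^ a / fact a * (y ^ b / fact b))) summable_on UNIV \<times> UNIV"
    by (simp add: case_prod_unfold norm_mult norm_divide norm_power)
  then show "(\<lambda>(a, b). x ^ a / fact a * (y ^ b / fact b)) summable_on UNIV \<times> UNIV"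
    by (rule abs_summable_summable)
  show "((\<lambda>b. (\<lambda>(a, b). x ^ a / fact a * (y ^ b / fact b)) (a, b)) has_sum x ^ a / fact a * exp y) UNIV" for a
    using has_sum_cmult_right[OF exp_has_sum[of y], of "x ^ a / fact a"] by simp
  show "((\<lambda>a. x ^ a / fact a * exp y) has_sum exp x * exp y) UNIV"
    by (rule has_sum_cmult_left[OF exp_has_sum])
qed

text \<open>
  The double series of a product of exponentials, grouped by the difference \<open>k = a - b\<close> of the two
  exponents: \<open>(a, b)\<close> corresponds to \<open>k\<close> and \<open>n = min a b\<close>. Each diagonal is a Bessel series.
\<close>
lemma exp_times_exp_has_sum_diagonals:
  fixes x y :: complex
  shows "((\<lambda>(k, n). x ^ (n + nat k) * y ^ (n + nat (- k)) / (fact (n + nat k) * fact (n + nat (- k))))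
      has_sum exp x * exp y) (UNIV \<times> (UNIV :: nat set))"
proof -
  have "bij_betw (\<lambda>(k, n). (n + nat k, n + nat (- k))) (UNIV \<times> UNIV) (UNIV \<times> UNIV)"
    by (rule bij_betwI[where g = "\<lambda>(a, b). (int a - int b, min a b)"]) auto
  from has_sum_reindex_bij_betw[OF this, THEN iffD2, OF exp_times_exp_has_sum[of x y]]
  show ?thesis by (simp add: case_prod_unfold)
qed

lemma bessel_I_has_sum:
  assumes "0 \<le> t"
  shows "((\<lambda>n. t ^ (2 * n + nat \<bar>k\<bar>) / (fact (n + nat k) * fact (n + nat (- k))))
    has_sum bessel_I k (2 * t)) UNIV"
proof -
  let ?f = "\<lambda>n. t ^ (2 * n + nat \<bar>k\<bar>) / (fact (n + nat k) * fact (n + nat (- k)))"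
  let ?c = "complex_of_real t"
  have eq: "of_real (?f n) = ?c ^ (n + nat k) * ?c ^ (n + nat (- k)) / (fact (n + nat k) * fact (n + nat (- k)))" for n
  proof -
    have "2 * n + nat \<bar>k\<bar> = (n + nat k) + (n + nat (- k))" by simp
    then show ?thesis by (simp only: power_add of_real_divide of_real_mult of_real_power of_real_fact)
  qed
  have "(\<lambda>n. complex_of_real (?f n)) summable_on UNIV"
    unfolding eq
    using summable_on_SigmaD1[OF has_sum_imp_summable[OF exp_times_exp_has_sum_diagonals[of ?c ?c]], of k]
    by simp
  from summable_on_Re[OF this] have s: "?f summable_on UNIV"
    by (simp only: Re_complex_of_real)
  have "bessel_I k (2 * t) = (\<Sum>n. ?f n)"
  proof (cases k rule: int_cases2)
    case (nonneg m)
    then show ?thesis by (simp add: bessel_I_of_nat mult_ac)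
  next
    case (nonpos m)
    then show ?thesis by (simp add: bessel_I_of_nat bessel_I_minus mult_ac)
  qed
  then show ?thesis
    using has_sum_imp_sums[OF has_sum_infsum[OF s]] has_sum_infsum[OF s] by (simp add: sums_iff)
qed

text \<open>
  Since \<open>exp (t z) exp (t / z)\<close> is a double series in \<open>z\<^bsup>a - b\<^esup>\<close>, its diagonal \<open>a - b = k\<close> collects exactly
  the coefficient of \<open>z\<^sup>k\<close>.
\<close>
theorem bessel_I_generating_function:
  fixes z :: complex
  assumes "0 \<le> t" and "z \<noteq> 0"
  shows "((\<lambda>k. of_real (bessel_I k (2 * t)) * z powi k) has_sum exp (of_real t * (z + inverse z))) UNIV"
proof (rule has_sum_SigmaD)
  show "((\<lambda>(k, n). (of_real t * z) ^ (n + nat k) * (of_real t * inverse z) ^ (n + nat (- k)) /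
      (fact (n + nat k) * fact (n + nat (- k)))) has_sum exp (of_real t * (z + inverse z)))
      (UNIV \<times> (UNIV :: nat set))"
    using exp_times_exp_has_sum_diagonals[of "of_real t * z" "of_real t * inverse z"]
    by (simp add: exp_add[symmetric] distrib_left)
  fix k :: int
  have "(of_real t * z) ^ (n + nat k) * (of_real t * inverse z) ^ (n + nat (- k)) /
      (fact (n + nat k) * fact (n + nat (- k))) =
      of_real (t ^ (2 * n + nat \<bar>k\<bar>) / (fact (n + nat k) * fact (n + nat (- k)))) * z powi k" for n
  proof -
    have 1: "2 * n + nat \<bar>k\<bar> = (n + nat k) + (n + nat (- k))" by simp
    have 2: "z ^ (n + nat k) * inverse z ^ (n + nat (- k)) = z powi k"
      using assms(2) by (cases k rule: int_cases2) (simp_all add: power_add field_simps power_int_minus)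
    have "(of_real t * z) ^ (n + nat k) * (of_real t * inverse z) ^ (n + nat (- k)) =
       of_real t ^ (n + nat k) * of_real t ^ (n + nat (- k)) * (z ^ (n + nat k) * inverse z ^ (n + nat (- k)))"
      by (simp only: power_mult_distrib mult_ac)
    also have "\<dots> = of_real t ^ (2 * n + nat \<bar>k\<bar>) * z powi k"
      unfolding 2 1 by (simp only: power_add)
    finally show ?thesis by simp
  qed
  then show "((\<lambda>n. (\<lambda>(k, n). (of_real t * z) ^ (n + nat k) * (of_real t * inverse z) ^ (n + nat (- k)) /
      (fact (n + nat k) * fact (n + nat (- k)))) (k, n)) has_sum
      of_real (bessel_I k (2 * t)) * z powi k) UNIV"
    using has_sum_cmult_left[OF has_sum_of_real[OF bessel_I_has_sum[OF assms(1), of k]], of "z powi k"]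
    by simp
qed

lemma bessel_I_nonneg: "0 \<le> t \<Longrightarrow> 0 \<le> bessel_I k (2 * t)"
  by (rule has_sum_nonneg[OF bessel_I_has_sum]) auto

lemma bessel_I_measurable [measurable]: "bessel_I k \<in> borel_measurable borel"
proof -
  have *: "bessel_I (int n) \<in> borel_measurable borel" for n
    unfolding bessel_I_of_nat[abs_def] by measurable
  have "bessel_I k = bessel_I (int (nat \<bar>k\<bar>))"
    by (cases k rule: int_cases2) (auto simp: bessel_I_minus[abs_def])
  then show ?thesis using *[of "nat \<bar>k\<bar>"] by (simp only:)
qed

section \<open>Characters of the cyclic group and the heat kernel on the circle\<close>

text \<open>The character \<open>n \<mapsto> e\<^bsup>2\<pi>in/M\<^esup>\<close> of \<open>\<int>/M\<close> for the odd modulus \<open>M = 2N + 1\<close>.\<close>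
definition unity_char :: "nat \<Rightarrow> int \<Rightarrow> complex" where
  "unity_char N n = cis (2 * pi * real_of_int n / (2 * real N + 1))"

lemma unity_char_0 [simp]: "unity_char N 0 = 1"
  by (simp add: unity_char_def)

lemma unity_char_add: "unity_char N (m + n) = unity_char N m * unity_char N n"
  by (simp add: unity_char_def cis_mult distrib_left add_divide_distrib)

lemma unity_char_neq_0 [simp]: "unity_char N n \<noteq> 0"
  by (simp add: unity_char_def)

lemma unity_char_minus: "unity_char N (- n) = inverse (unity_char N n)"
  by (simp add: unity_char_def)

lemma unity_char_sum: "unity_char N (\<Sum>i\<in>A. f i) = (\<Prod>i\<in>A. unity_char N (f i))"
  by (induction A rule: infinite_finite_induct) (simp_all add: unity_char_add)

lemma unity_char_mult: "unity_char N (k * n) = unity_char N n powi k"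
proof -
  have nat: "unity_char N (int k * n) = unity_char N n ^ k" for k
    by (induction k) (simp_all add: unity_char_add distrib_right)
  show ?thesis
    by (cases k rule: int_cases2) (simp_all add: nat unity_char_minus power_int_minus)
qed

lemma unity_char_eq_1_iff: "unity_char N n = 1 \<longleftrightarrow> (2 * int N + 1) dvd n"
proof -
  have "unity_char N n = 1 \<longleftrightarrow> (\<exists>q::int. 2 * pi * real_of_int n / (2 * real N + 1) = of_int (2 * q) * pi)"
    unfolding unity_char_def cis_conv_exp exp_eq_1 by simp
  also have "\<dots> \<longleftrightarrow> (\<exists>q::int. real_of_int n = real_of_int ((2 * int N + 1) * q))"
  proof -
    have "2 * pi * real_of_int n / (2 * real N + 1) = of_int (2 * q) * pi \<longleftrightarrow>
       real_of_int n = real_of_int ((2 * int N + 1) * q)" for q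
      by (simp add: divide_eq_eq) (simp add: algebra_simps)
    then show ?thesis by simp
  qed
  also have "\<dots> \<longleftrightarrow> (2 * int N + 1) dvd n"
    by (simp only: of_int_eq_iff dvd_def)
  finally show ?thesis .
qed

text \<open>
  Orthogonality of characters: after shifting the summation range to \<open>{0..<M}\<close> this is a geometric sum
  whose ratio is an \<open>M\<close>-th root of unity.
\<close>
lemma sum_unity_char:
  "(\<Sum>k\<in>{- int N..int N}. unity_char N (k * n)) = (if (2 * int N + 1) dvd n then 2 * of_nat N + 1 else 0)"
proof -
  let ?z = "unity_char N n"
  have "bij_betw (\<lambda>i. int i - int N) {..<2 * N + 1} {- int N..int N}"
    by (rule bij_betwI[where g = "\<lambda>k. nat (k + int N)"]) auto
  from sum.reindex_bij_betw[OF this, of "\<lambda>k. unity_char N (k * n)"]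
  have "(\<Sum>k\<in>{- int N..int N}. unity_char N (k * n)) = (\<Sum>i<2 * N + 1. unity_char N ((int i - int N) * n))"
    by simp
  also have "\<dots> = (\<Sum>i<2 * N + 1. ?z ^ i * ?z powi (- int N))"
  proof (rule sum.cong)
    fix i
    have "unity_char N ((int i - int N) * n) = ?z powi int i * ?z powi (- int N)"
      unfolding unity_char_mult by (simp only: power_int_add[OF disjI1[OF unity_char_neq_0], symmetric]) simp
    then show "unity_char N ((int i - int N) * n) = ?z ^ i * ?z powi (- int N)" by simp
  qed simp
  also have "\<dots> = (\<Sum>i<2 * N + 1. ?z ^ i) * ?z powi (- int N)"
    by (simp only: sum_distrib_right)
  finally have eq: "(\<Sum>k\<in>{- int N..int N}. unity_char N (k * n)) =
    (\<Sum>i<2 * N + 1. ?z ^ i) * ?z powi (- int N)" .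
  show ?thesis
  proof (cases "(2 * int N + 1) dvd n")
    case True
    then show ?thesis using unity_char_eq_1_iff[of N n] eq by simp
  next
    case False
    then have "?z \<noteq> 1" by (simp add: unity_char_eq_1_iff)
    moreover have "?z ^ (2 * N + 1) = 1"
    proof -
      have "?z ^ (2 * N + 1) = unity_char N ((2 * int N + 1) * n)"
        unfolding unity_char_mult by (simp add: power_int_def nat_add_distrib nat_mult_distrib)
      also have "\<dots> = 1" by (simp only: unity_char_eq_1_iff dvd_triv_left)
      finally show ?thesis .
    qed
    ultimately have "(\<Sum>i<2 * N + 1. ?z ^ i) = 0"
      using geometric_sum[of ?z "2 * N + 1"] by simp
    then show ?thesis using False eq by simp
  qed
qed

lemma has_sum_finite_sum:
  fixes f :: "'a \<Rightarrow> 'b \<Rightarrow> 'c :: topological_comm_monoid_add"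
  assumes "finite A" "\<And>k. k \<in> A \<Longrightarrow> (f k has_sum S k) B"
  shows "((\<lambda>m. \<Sum>k\<in>A. f k m) has_sum (\<Sum>k\<in>A. S k)) B"
  using assms by (induction A) (auto intro!: has_sum_add)

text \<open>
  The generating function at \<open>z = \<chi>(-k)\<close> equals \<open>exp (2t - 4t sin\<^sup>2(k\<pi>/M))\<close>. Multiplying by \<open>\<chi>(kn)\<close> and
  averaging over \<open>k\<close> keeps on the Bessel side only the indices congruent to \<open>n\<close> modulo \<open>M\<close>.
\<close>
lemma circle_heat_kernel_periodization:
  assumes "0 \<le> t"
  shows "((\<lambda>k. complex_of_real (exp (- 2 * t) * bessel_I (n + (2 * int N + 1) * k) (2 * t))) has_sum
    1 / (2 * of_nat N + 1) * (\<Sum>k\<in>{- int N..int N}.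
       of_real (exp (- t * (4 * (sin (real_of_int k * pi / (2 * real N + 1)))\<^sup>2))) * unity_char N (k * n))) UNIV"
proof -
  let ?e = "\<lambda>k. complex_of_real (exp (- t * (4 * (sin (real_of_int k * pi / (2 * real N + 1)))\<^sup>2)))"
  let ?I = "\<lambda>m. complex_of_real (exp (- 2 * t) * bessel_I m (2 * t))"
  let ?D = "{m. (2 * int N + 1) dvd n - m}"
  have "((\<lambda>m. ?I m * unity_char N (k * (n - m))) has_sum ?e k * unity_char N (k * n)) UNIV" for k
  proof -
    let ?z = "unity_char N (- k)"
    have "?z + inverse ?z = of_real (2 * cos (2 * (real_of_int k * pi / (2 * real N + 1))))"
      by (simp add: unity_char_def complex_eq_iff mult_ac)
    also have "\<dots> = of_real (2 - 4 * (sin (real_of_int k * pi / (2 * real N + 1)))\<^sup>2)"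
      by (simp only: cos_double_sin) simp
    finally have z: "?z + inverse ?z = of_real (2 - 4 * (sin (real_of_int k * pi / (2 * real N + 1)))\<^sup>2)" .
    have e: "of_real (exp (- 2 * t)) * exp (of_real t * (?z + inverse ?z)) = ?e k"
      unfolding z of_real_mult[symmetric] exp_of_real exp_add[symmetric] of_real_add[symmetric]
      by (simp add: algebra_simps)
    have "((\<lambda>m. of_real (bessel_I m (2 * t)) * ?z powi m * (of_real (exp (- 2 * t)) * unity_char N (k * n))) has_sum
      exp (of_real t * (?z + inverse ?z)) * (of_real (exp (- 2 * t)) * unity_char N (k * n))) UNIV"
      by (rule has_sum_cmult_left[OF bessel_I_generating_function]) (use assms in auto)
    also have "exp (of_real t * (?z + inverse ?z)) * (of_real (exp (- 2 * t)) * unity_char N (k * n)) =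
       ?e k * unity_char N (k * n)"
      using e by (simp add: mult_ac)
    also have "(\<lambda>m. of_real (bessel_I m (2 * t)) * ?z powi m * (of_real (exp (- 2 * t)) * unity_char N (k * n)))
      = (\<lambda>m. ?I m * unity_char N (k * (n - m)))"
    proof
      fix m
      have "?z powi m * unity_char N (k * n) = unity_char N (k * (n - m))"
        unfolding unity_char_mult[symmetric] unity_char_add[symmetric] by (simp add: algebra_simps)
      then show "of_real (bessel_I m (2 * t)) * ?z powi m * (of_real (exp (- 2 * t)) * unity_char N (k * n))
        = ?I m * unity_char N (k * (n - m))" by (simp add: mult_ac)
    qed
    finally show ?thesis .
  qed
  from has_sum_finite_sum[OF _ this, of "{- int N..int N}" "\<lambda>k. k"]
  have "((\<lambda>m. ?I m * (\<Sum>k\<in>{- int N..int N}. unity_char N (k * (n - m)))) has_sum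
      (\<Sum>k\<in>{- int N..int N}. ?e k * unity_char N (k * n))) UNIV"
    by (simp add: sum_distrib_left)
  then have "((\<lambda>m. ?I m * (if (2 * int N + 1) dvd (n - m) then 2 * of_nat N + 1 else 0)) has_sum
      (\<Sum>k\<in>{- int N..int N}. ?e k * unity_char N (k * n))) UNIV"
    by (simp only: sum_unity_char)
  then have "((\<lambda>m. ?I m * (2 * of_nat N + 1)) has_sum (\<Sum>k\<in>{- int N..int N}. ?e k * unity_char N (k * n))) ?D"
    by (subst (asm) has_sum_cong_neutral[where T = ?D and g = "\<lambda>m. ?I m * (2 * of_nat N + 1)"]) auto
  from has_sum_cmult_right[OF this, of "1 / (2 * of_nat N + 1)"]
  have "(?I has_sum 1 / (2 * of_nat N + 1) * (\<Sum>k\<in>{- int N..int N}. ?e k * unity_char N (k * n))) ?D"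
  proof -
    have "(2 * of_nat N + 1 :: complex) \<noteq> 0"
      by (metis of_nat_1 of_nat_add of_nat_eq_0_iff of_nat_mult of_nat_numeral add_eq_0_iff_both_eq_0 one_neq_zero)
    then have "(\<lambda>m. 1 / (2 * of_nat N + 1) * (?I m * (2 * of_nat N + 1))) = ?I" by auto
    then show ?thesis
      using \<open>((\<lambda>m. 1 / (2 * of_nat N + 1) * (?I m * (2 * of_nat N + 1))) has_sum _) ?D\<close> by simp
  qed
  moreover have "bij_betw (\<lambda>k. n + (2 * int N + 1) * k) UNIV ?D"
  proof (rule bij_betw_imageI)
    show "inj (\<lambda>k. n + (2 * int N + 1) * k)" by (rule injI) simp
    show "range (\<lambda>k. n + (2 * int N + 1) * k) = ?D"
    proof (intro set_eqI iffI)
      fix m assume "m \<in> ?D"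
      then obtain q where "n - m = (2 * int N + 1) * q" by (auto simp: dvd_def)
      then have "m = n + (2 * int N + 1) * (- q)" by simp
      then show "m \<in> range (\<lambda>k. n + (2 * int N + 1) * k)" by blast
    qed auto
  qed
  ultimately show ?thesis
    by (subst has_sum_reindex_bij_betw) 
qed

section \<open>The heat kernel on the torus\<close>

text \<open>
  A distributive law for infinite sums. For nonnegative terms every finite partial sum of products
  embeds into a finite box, where the finite distributive law bounds it by the product of the sums.
\<close>
lemma has_sum_prod_PiE_nonneg:
  fixes f :: "'a \<Rightarrow> 'b \<Rightarrow> real"
  assumes "finite A"
    and f: "\<And>x. x \<in> A \<Longrightarrow> (f x has_sum S x) (B x)"
    and nonneg: "\<And>x y. x \<in> A \<Longrightarrow> y \<in> B x \<Longrightarrow> 0 \<le> f x y"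
  shows "((\<lambda>g. \<Prod>x\<in>A. f x (g x)) has_sum (\<Prod>x\<in>A. S x)) (PiE A B)"
proof -
  have "(\<Sum>g\<in>F. \<Prod>x\<in>A. f x (g x)) \<le> (\<Prod>x\<in>A. S x)" if F: "F \<subseteq> PiE A B" "finite F" for F
  proof -
    define C where "C x = (\<lambda>g. g x) ` F" for x
    have C: "finite (C x)" "x \<in> A \<Longrightarrow> C x \<subseteq> B x" for x
      using F by (auto simp: C_def PiE_def Pi_def)
    have "(\<Sum>g\<in>F. \<Prod>x\<in>A. f x (g x)) \<le> (\<Sum>g\<in>PiE A C. \<Prod>x\<in>A. f x (g x))"
    proof (rule sum_mono2)
      show "finite (PiE A C)" by (rule finite_PiE) (use \<open>finite A\<close> C in auto)
      show "F \<subseteq> PiE A C" using F by (auto simp: C_def PiE_def Pi_def)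
      show "0 \<le> (\<Prod>x\<in>A. f x (g x))" if "g \<in> PiE A C - F" for g
      proof (intro prod_nonneg ballI nonneg)
        show "g x \<in> B x" if "x \<in> A" for x
          using that C(2)[of x] \<open>g \<in> PiE A C - F\<close> by (auto simp: PiE_iff)
      qed
    qed
    also have "\<dots> = (\<Prod>x\<in>A. \<Sum>y\<in>C x. f x y)"
      by (rule prod_sum_PiE[symmetric]) (use \<open>finite A\<close> C in auto)
    also have "\<dots> \<le> (\<Prod>x\<in>A. S x)"
    proof (intro prod_mono conjI)
      fix x assume x: "x \<in> A"
      show "0 \<le> (\<Sum>y\<in>C x. f x y)"
        using C(2)[OF x] by (intro sum_nonneg nonneg[OF x]) auto
      show "(\<Sum>y\<in>C x. f x y) \<le> S x"
        using C nonneg[OF x] x by (intro finite_sum_le_has_sum[OF f]) auto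
    qed
    finally show ?thesis .
  qed
  then have "(\<lambda>g. \<Prod>x\<in>A. f x (g x)) summable_on PiE A B"
    using nonneg by (intro nonneg_bdd_above_summable_on prod_nonneg bdd_aboveI) (auto simp: PiE_def Pi_def)
  moreover have "infsum (\<lambda>g. \<Prod>x\<in>A. f x (g x)) (PiE A B) = (\<Prod>x\<in>A. infsum (f x) (B x))"
    by (intro infsum_prod_PiE \<open>finite A\<close> calculation has_sum_imp_summable[OF f])
  moreover have "(\<Prod>x\<in>A. infsum (f x) (B x)) = (\<Prod>x\<in>A. S x)"
    by (intro prod.cong refl infsumI f)
  ultimately show ?thesis by (simp add: has_sum_iff)
qed

text \<open>The eigenvalue at frequency \<open>k\<close> of the negative Laplacian on the torus with unit step.\<close>
definition torus_symbol :: "nat \<Rightarrow> int ^ 'd \<Rightarrow> real" where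
  "torus_symbol N k = (\<Sum>i\<in>UNIV. 4 * (sin (real_of_int (k $ i) * pi / (2 * real N + 1)))\<^sup>2)"

lemma bij_vec_nth: "bij_betw vec_nth (UNIV :: ('a ^ 'd) set) (PiE UNIV (\<lambda>_. UNIV))"
  by (rule bij_betwI[where g = vec_lambda]) auto

lemma bij_vec_nth_cube:
  "bij_betw vec_nth (index_cube N :: (int ^ 'd) set) (PiE UNIV (\<lambda>_. {- int N..int N}))"
  by (rule bij_betwI[where g = vec_lambda]) (auto simp: index_cube_def)

lemma finite_index_cube [simp]: "finite (index_cube N :: (int ^ 'd) set)"
  using bij_betw_finite[OF bij_vec_nth_cube[of N]] by (simp add: finite_PiE)

lemma sum_prod_index_cube:
  fixes f :: "'d::finite \<Rightarrow> int \<Rightarrow> 'a::comm_semiring_1"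
  shows "(\<Sum>k\<in>index_cube N. \<Prod>i\<in>UNIV. f i (k $ i)) = (\<Prod>i\<in>UNIV. \<Sum>k\<in>{- int N..int N}. f i k)"
  unfolding sum.reindex_bij_betw[OF bij_vec_nth_cube, of "\<lambda>g. \<Prod>i\<in>UNIV. f i (g i)"]
  by (rule prod_sum_PiE[symmetric]) auto

lemma mem_range_lattice_iff:
  "(n :: int ^ 'd) \<in> range (\<lambda>k. M *s k) \<longleftrightarrow> (\<forall>i. M dvd n $ i)"
proof
  assume "\<forall>i. M dvd n $ i"
  then have "n = M *s (\<chi> i. n $ i div M)" by (simp add: vec_eq_iff)
  then show "n \<in> range (\<lambda>k. M *s k)" by blast
qed auto

lemma sum_unity_char_index_cube:
  fixes n :: "int ^ 'd"
  shows "(\<Sum>k\<in>index_cube N. unity_char N (idot k n)) =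
    (if n \<in> range (\<lambda>k. (2 * int N + 1) *s k) then (2 * of_nat N + 1) ^ CARD('d) else 0)"
proof -
  have "(\<Sum>k\<in>index_cube N. unity_char N (idot k n)) =
    (\<Prod>i\<in>UNIV. \<Sum>k\<in>{- int N..int N}. unity_char N (k * n $ i))"
    unfolding idot_def unity_char_sum by (rule sum_prod_index_cube)
  also have "\<dots> = (\<Prod>i\<in>UNIV. if (2 * int N + 1) dvd n $ i then 2 * of_nat N + 1 else 0)"
    by (simp only: sum_unity_char)
  also have "\<dots> = (if \<forall>i. (2 * int N + 1) dvd n $ i then (2 * of_nat N + 1) ^ CARD('d) else 0)"
    by auto
  finally show ?thesis by (simp only: mem_range_lattice_iff)
qed

text \<open>
  Both sides factor over the coordinates, so the one-dimensional identity can be multiplied up. The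
  product of the infinite sums is taken over the reals, where all terms are nonnegative.
\<close>
theorem torus_heat_kernel_periodization:
  fixes n :: "int ^ 'd"
  assumes "0 \<le> t"
  shows "((\<lambda>k. complex_of_real (exp (- 2 * real CARD('d) * t) *
        (\<Prod>i\<in>UNIV. bessel_I ((n + (2 * int N + 1) *s k) $ i) (2 * t)))) has_sum
      1 / (2 * of_nat N + 1) ^ CARD('d) *
      (\<Sum>k\<in>index_cube N. of_real (exp (- t * torus_symbol N k)) * unity_char N (idot k n))) UNIV"
proof -
  let ?f = "\<lambda>i k. exp (- 2 * t) * bessel_I (n $ i + (2 * int N + 1) * k) (2 * t)"
  let ?e = "\<lambda>k. complex_of_real (exp (- t * (4 * (sin (real_of_int k * pi / (2 * real N + 1)))\<^sup>2)))"
  define R where "R i = 1 / (2 * of_nat N + 1) * (\<Sum>k\<in>{- int N..int N}. ?e k * unity_char N (k * n $ i))" for i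
  have c: "((\<lambda>k. complex_of_real (?f i k)) has_sum R i) UNIV" for i
    unfolding R_def by (rule circle_heat_kernel_periodization[OF assms])
  have r: "(?f i has_sum Re (R i)) UNIV" for i
    using has_sum_Re[OF c[of i]] by simp
  have R: "R i = of_real (Re (R i))" for i
    using has_sum_unique[OF c has_sum_of_real[OF r]] .
  have "((\<lambda>g. \<Prod>i\<in>UNIV. ?f i (g i)) has_sum (\<Prod>i\<in>UNIV. Re (R i))) (PiE UNIV (\<lambda>_. UNIV))"
    by (rule has_sum_prod_PiE_nonneg) (use r bessel_I_nonneg[OF assms] in auto)
  then have "((\<lambda>k. \<Prod>i\<in>UNIV. ?f i (k $ i)) has_sum (\<Prod>i\<in>UNIV. Re (R i))) UNIV"
    by (subst has_sum_reindex_bij_betw[OF bij_vec_nth, of "\<lambda>g. \<Prod>i\<in>UNIV. ?f i (g i)"])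
  then have "((\<lambda>k. complex_of_real (\<Prod>i\<in>UNIV. ?f i (k $ i))) has_sum of_real (\<Prod>i\<in>UNIV. Re (R i))) UNIV"
    by (rule has_sum_of_real)
  also have "(\<lambda>k. complex_of_real (\<Prod>i\<in>UNIV. ?f i (k $ i))) = (\<lambda>k. complex_of_real (exp (- 2 * real CARD('d) * t) *
        (\<Prod>i\<in>UNIV. bessel_I ((n + (2 * int N + 1) *s k) $ i) (2 * t))))"
    by (simp add: prod.distrib exp_of_nat_mult[symmetric] algebra_simps)
  also have "complex_of_real (\<Prod>i\<in>UNIV. Re (R i)) = (\<Prod>i\<in>UNIV. R i)"
    using R by simp
  also have "\<dots> = 1 / (2 * of_nat N + 1) ^ CARD('d) *
     (\<Prod>i\<in>UNIV. \<Sum>k\<in>{- int N..int N}. ?e k * unity_char N (k * n $ i))"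
    unfolding R_def prod.distrib by (simp add: power_one_over)
  also have "(\<Prod>i\<in>UNIV. \<Sum>k\<in>{- int N..int N}. ?e k * unity_char N (k * n $ i)) =
    (\<Sum>k\<in>index_cube N. \<Prod>i\<in>UNIV. ?e (k $ i) * unity_char N (k $ i * n $ i))"
    by (rule sum_prod_index_cube[symmetric])
  also have "\<dots> = (\<Sum>k\<in>index_cube N. of_real (exp (- t * torus_symbol N k)) * unity_char N (idot k n))"
    by (simp add: prod.distrib idot_def unity_char_sum torus_symbol_def exp_sum sum_distrib_left sum_negf[symmetric])
  finally show ?thesis .
qed

section \<open>Fractional powers as Gamma integrals\<close>

lemma nn_integral_Gamma_scaled:
  assumes a: "0 < a" and c: "0 < (c::real)"
  shows "(\<integral>\<^sup>+t. ennreal (indicator {0<..} t * (t powr (a - 1) * exp (- (c * t)))) \<partial>lborel) = ennreal (Gamma a / c powr a)"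
proof -
  let ?f = "\<lambda>t. ennreal (indicator {0<..} t * (t powr (a - 1) * exp (- (c * t))))"
  have "ennreal (Gamma a) = (\<integral>\<^sup>+t. ennreal (indicator {0..} t * t powr (a - 1) / exp t) \<partial>lborel)"
    by (rule Gamma_conv_nn_integral_real[OF a])
  also have "\<dots> = ennreal c * (\<integral>\<^sup>+t. ennreal (indicator {0..} (c * t) * (c * t) powr (a - 1) / exp (c * t)) \<partial>lborel)"
    using c by (subst nn_integral_real_affine[where c = c and t = 0]) auto
  also have "(\<integral>\<^sup>+t. ennreal (indicator {0..} (c * t) * (c * t) powr (a - 1) / exp (c * t)) \<partial>lborel) =
      (\<integral>\<^sup>+t. ennreal (c powr (a - 1)) * ?f t \<partial>lborel)"
    using c
    by (intro nn_integral_cong)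
       (auto simp: indicator_def powr_mult zero_le_mult_iff exp_minus field_simps ennreal_mult'[symmetric])
  also have "\<dots> = ennreal (c powr (a - 1)) * (\<integral>\<^sup>+t. ?f t \<partial>lborel)"
    by (rule nn_integral_cmult) measurable
  also have "ennreal c * (ennreal (c powr (a - 1)) * (\<integral>\<^sup>+t. ?f t \<partial>lborel)) = ennreal (c powr a) * (\<integral>\<^sup>+t. ?f t \<partial>lborel)"
    using c by (simp add: mult.assoc[symmetric] ennreal_mult'[symmetric] powr_diff)
  finally have eq: "ennreal (Gamma a) = ennreal (c powr a) * (\<integral>\<^sup>+t. ?f t \<partial>lborel)" .
  have "ennreal (inverse (c powr a)) * ennreal (c powr a) = 1"
    using c by (subst ennreal_mult'[symmetric]) auto
  then have "(\<integral>\<^sup>+t. ?f t \<partial>lborel) = ennreal (inverse (c powr a)) * ennreal (Gamma a)"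
    unfolding eq by (simp only: mult.assoc[symmetric] mult_1_left)
  also have "\<dots> = ennreal (Gamma a / c powr a)"
    by (subst ennreal_mult'[symmetric]) (simp_all add: field_simps)
  finally show ?thesis .
qed

lemma neg_notin_nonpos_Ints:
  fixes s :: real
  assumes "0 < s" "s < 1"
  shows "- s \<notin> \<int>\<^sub>\<le>\<^sub>0"
proof
  assume "- s \<in> \<int>\<^sub>\<le>\<^sub>0"
  then have "s \<in> \<int>" using nonpos_Ints_Int minus_in_Ints_iff by blast
  then show False using assms by (auto elim!: Ints_cases)
qed

text \<open>
  Write \<open>1 - e\<^sup>-\<^sup>t\<^sup>\<lambda>\<close> as \<open>t\<close> times the integral of \<open>e\<^sup>-\<^sup>x\<^sup>t\<close> over \<open>x \<in> [0, \<lambda>]\<close> and exchange the integrals: the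
  inner one is \<open>\<Gamma>(1-s) x\<^bsup>s-1\<^esup>\<close>, and \<open>\<Gamma>(1-s) = -s \<Gamma>(-s)\<close> supplies the constant. Stating it for the
  extended nonnegative integral gives integrability together with the value.
\<close>
lemma nn_integral_frac_power:
  assumes s: "0 < s" "s < 1" and l: "0 \<le> (l::real)"
  shows "(\<integral>\<^sup>+t. ennreal (indicator {0<..} t * ((1 - exp (- (t * l))) / t powr (1 + s))) \<partial>lborel)
    = ennreal (\<bar>Gamma (- s)\<bar> * l powr s)"
proof -
  let ?h = "\<lambda>t x. ennreal (indicator {0..l} x * (indicator {0<..} t * (t powr (- s) * exp (- (x * t)))))"
  have "(\<integral>\<^sup>+t. ennreal (indicator {0<..} t * ((1 - exp (- (t * l))) / t powr (1 + s))) \<partial>lborel)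
     = (\<integral>\<^sup>+t. (\<integral>\<^sup>+x. ?h t x \<partial>lborel) \<partial>lborel)"
  proof (intro nn_integral_cong)
    fix t :: real
    show "ennreal (indicator {0<..} t * ((1 - exp (- (t * l))) / t powr (1 + s))) = (\<integral>\<^sup>+x. ?h t x \<partial>lborel)"
    proof (cases "0 < t")
      case True
      have "((\<lambda>x. t powr (- s) * exp (- (x * t))) has_integral
         (- (t powr (- s) * exp (- (l * t)) / t) - - (t powr (- s) * exp (- (0 * t)) / t))) {0..l}"
        by (rule fundamental_theorem_of_calculus)
           (use l True in \<open>auto intro!: derivative_eq_intros simp: has_real_derivative_iff_has_vector_derivative[symmetric]\<close>)
      from nn_integral_has_integral_lebesgue[OF _ this]
      have "(\<integral>\<^sup>+x. ennreal (indicator {0..l} x * (t powr (- s) * exp (- (x * t)))) \<partial>lborel)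
         = ennreal (t powr (- s) / t - t powr (- s) * exp (- (l * t)) / t)" by simp
      also have "t powr (- s) / t - t powr (- s) * exp (- (l * t)) / t = (1 - exp (- (t * l))) / t powr (1 + s)"
        using True by (simp add: powr_add powr_minus field_simps)
      finally show ?thesis using True by simp
    qed simp
  qed
  also have "\<dots> = (\<integral>\<^sup>+x. (\<integral>\<^sup>+t. ?h t x \<partial>lborel) \<partial>lborel)"
    by (rule lborel_pair.Fubini'[symmetric]) measurable
  also have "\<dots> = (\<integral>\<^sup>+x. ennreal (indicator {0..l} x * (Gamma (1 - s) * x powr (s - 1))) \<partial>lborel)"
  proof (rule nn_integral_cong_AE)
    show "AE x in lborel. (\<integral>\<^sup>+t. ?h t x \<partial>lborel) = ennreal (indicator {0..l} x * (Gamma (1 - s) * x powr (s - 1)))"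
      \<comment> \<open>At \<open>x = 0\<close> the inner integral diverges, so that point is left out.\<close>
      using AE_lborel_singleton[of 0]
    proof eventually_elim
      fix x :: real assume x: "x \<noteq> 0"
      show "(\<integral>\<^sup>+t. ?h t x \<partial>lborel) = ennreal (indicator {0..l} x * (Gamma (1 - s) * x powr (s - 1)))"
      proof (cases "0 < x \<and> x \<le> l")
        case True
        then have "(\<integral>\<^sup>+t. ?h t x \<partial>lborel) =
           (\<integral>\<^sup>+t. ennreal (indicator {0<..} t * (t powr ((1 - s) - 1) * exp (- (x * t)))) \<partial>lborel)"
          by simp
        also have "\<dots> = ennreal (Gamma (1 - s) / x powr (1 - s))"
          by (rule nn_integral_Gamma_scaled) (use True s in auto)
        also have "Gamma (1 - s) / x powr (1 - s) = Gamma (1 - s) * x powr (s - 1)"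
          using powr_minus_divide[of x "1 - s"] by simp
        finally show ?thesis using True by simp
      qed (use x in auto)
    qed
  qed
  also have "\<dots> = ennreal (Gamma (1 - s) * (l powr s / s))"
  proof (rule nn_integral_has_integral_lebesgue)
    show "((\<lambda>x. Gamma (1 - s) * x powr (s - 1)) has_integral Gamma (1 - s) * (l powr s / s)) {0..l}"
      using has_integral_mult_right[OF has_integral_powr_from_0[of "s - 1" l], of "Gamma (1 - s)"] s l by simp
    show "0 \<le> Gamma (1 - s) * x powr (s - 1)" for x
      using Gamma_real_pos[of "1 - s"] s by simp
  qed
  also have "Gamma (1 - s) * (l powr s / s) = \<bar>Gamma (- s)\<bar> * l powr s"
  proof -
    have "- s \<notin> \<int>\<^sub>\<le>\<^sub>0" by (rule neg_notin_nonpos_Ints[OF s])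
    then have "Gamma (1 - s) = (- s) * Gamma (- s)"
      using Gamma_plus1[of "- s"] by simp
    moreover have "0 < Gamma (1 - s)" using s by (simp add: Gamma_real_pos)
    ultimately have "\<bar>Gamma (- s)\<bar> = Gamma (1 - s) / s"
      using s by (simp add: field_simps zero_less_mult_iff mult_less_0_iff abs_if)
    then show ?thesis by simp
  qed
  finally show ?thesis .
qed

section \<open>The kernel of the fractional Laplacian\<close>

lemma has_bochner_integral_frac_power:
  assumes s: "0 < s" "s < 1" and l: "0 \<le> (l::real)"
  shows "has_bochner_integral lborel (\<lambda>t. indicator {0<..} t * ((1 - exp (- (t * l))) / t powr (1 + s)))
    (\<bar>Gamma (- s)\<bar> * l powr s)"
  by (rule has_bochner_integral_nn_integral)
     (use nn_integral_frac_power[OF assms] l in \<open>auto simp: indicator_def\<close>)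

text \<open>
  Monotone convergence for sums over a countable type: an integrable total dominates every partial
  sum, which makes the series of integrals converge.
\<close>
lemma has_sum_integral_nonneg:
  fixes f :: "'i::countable \<Rightarrow> 'a \<Rightarrow> real"
  assumes meas [measurable]: "\<And>k. f k \<in> borel_measurable M"
    and nonneg: "\<And>k x. 0 \<le> f k x"
    and sum: "\<And>x. ((\<lambda>k. f k x) has_sum F x) UNIV"
    and int: "has_bochner_integral M F I"
  shows "((\<lambda>k. integral\<^sup>L M (f k)) has_sum I) UNIV"
proof -
  have intF: "integrable M F" and I: "integral\<^sup>L M F = I"
    using int by (auto simp: has_bochner_integral_iff)
  have intf: "integrable M (f k)" for k
  proof (rule Bochner_Integration.integrable_bound[OF intF])
    have "f k x \<le> F x" for x
      using finite_sum_le_has_sum[OF sum, of "{k}"] nonneg by simp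
    then show "AE x in M. norm (f k x) \<le> norm (F x)"
      using nonneg[of k] by (smt (verit) AE_I2 real_norm_def)
  qed simp
  \<comment> \<open>Enumerate the index type by natural numbers, padding with zero, to use the theory of series.\<close>
  define g where "g n = (if n \<in> range (to_nat :: 'i \<Rightarrow> nat) then f (from_nat n) else (\<lambda>_. 0))" for n
  have reindex: "((\<lambda>n. G (g n)) has_sum S) UNIV \<longleftrightarrow> ((\<lambda>k. G (f k)) has_sum S) UNIV"
    if "G (\<lambda>_. 0) = 0" for G :: "('a \<Rightarrow> real) \<Rightarrow> real" and S
  proof -
    have "((\<lambda>n. G (g n)) has_sum S) UNIV \<longleftrightarrow> ((\<lambda>n. G (g n)) has_sum S) (range (to_nat :: 'i \<Rightarrow> nat))"
      by (rule has_sum_cong_neutral) (auto simp: g_def that)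
    also have "\<dots> \<longleftrightarrow> ((\<lambda>k. G (f k)) has_sum S) UNIV"
      by (subst has_sum_reindex) (auto simp: o_def g_def)
    finally show ?thesis .
  qed
  have gsums: "(\<lambda>n. g n x) sums F x" for x
    using reindex[of "\<lambda>u. u x" "F x"] sum[of x] by (intro has_sum_imp_sums) simp
  have gint: "integrable M (g n)" and gnn: "0 \<le> g n x" for n x
    by (auto simp: g_def intf nonneg)
  have sm: "summable (\<lambda>n. integral\<^sup>L M (g n))"
  proof (rule summableI_nonneg_bounded)
    show "0 \<le> integral\<^sup>L M (g n)" for n by (intro integral_nonneg_AE) (simp add: gnn)
    show "(\<Sum>i<n. integral\<^sup>L M (g i)) \<le> I" for n
    proof -
      have "(\<Sum>i<n. integral\<^sup>L M (g i)) = (\<integral>x. (\<Sum>i<n. g i x) \<partial>M)"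
        by (rule Bochner_Integration.integral_sum[symmetric]) (rule gint)
      also have "\<dots> \<le> integral\<^sup>L M F"
      proof (rule integral_mono)
        show "(\<Sum>i<n. g i x) \<le> F x" for x
          using sum_le_suminf[of "\<lambda>i. g i x" "{..<n}"] gsums[of x] gnn by (simp add: sums_iff)
      qed (auto intro: gint intF)
      finally show ?thesis by (simp add: I)
    qed
  qed
  have sm': "summable (\<lambda>n. g n x)" and F: "F x = (\<Sum>n. g n x)" for x
    using gsums[of x] by (auto simp: sums_iff)
  have "(\<integral>x. (\<Sum>n. g n x) \<partial>M) = (\<Sum>n. integral\<^sup>L M (g n))"
    by (rule integral_suminf) (use gint sm sm' gnn in auto)
  moreover have "(\<integral>x. (\<Sum>n. g n x) \<partial>M) = I"
    unfolding F[symmetric] by (rule I)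
  ultimately have "(\<lambda>n. integral\<^sup>L M (g n)) sums I"
    using sm by (simp add: sums_iff)
  then have "((\<lambda>n. integral\<^sup>L M (g n)) has_sum I) UNIV"
    by (intro sums_nonneg_imp_has_sum) (auto intro!: integral_nonneg_AE simp: gnn)
  then show ?thesis by (subst (asm) reindex) auto
qed

text \<open>
  The convolution kernel \<open>W\<close> of the \<open>s\<close>-th power of the negative Laplacian on the torus with unit step,
  that is, the inverse discrete Fourier transform of \<open>\<lambda>\<^sup>s\<close>.
\<close>
definition torus_power_kernel :: "nat \<Rightarrow> real \<Rightarrow> int ^ 'd \<Rightarrow> complex" where
  "torus_power_kernel N s n = 1 / (2 * of_nat N + 1) ^ CARD('d) *
     (\<Sum>k\<in>index_cube N. of_real (torus_symbol N k powr s) * unity_char N (idot k n))"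

lemma torus_symbol_nonneg: "0 \<le> torus_symbol N k"
  by (auto simp: torus_symbol_def intro!: sum_nonneg)

text \<open>
  Integrate the heat kernel identity against \<open>t\<^sup>-\<^sup>1\<^sup>-\<^sup>s\<close>. The finite Fourier sum on the torus side is not
  termwise integrable near \<open>0\<close>, but for \<open>n\<close> outside \<open>M\<int>\<^sup>d\<close> the characters sum to zero, so that each
  \<open>e\<^sup>-\<^sup>t\<^sup>\<lambda>\<close> may be replaced by \<open>-(1 - e\<^sup>-\<^sup>t\<^sup>\<lambda>)\<close>.
\<close>
lemma lattice_kernel_has_sum:
  fixes n :: "int ^ 'd"
  assumes s: "0 < s" "s < 1" and n: "n \<notin> range (\<lambda>k. (2 * int N + 1) *s k)"
  shows "((\<lambda>k. complex_of_real (lattice_kernel h s (n + (2 * int N + 1) *s k))) has_sum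
    - torus_power_kernel N s n / of_real (h powr (2 * s))) UNIV"
proof -
  define H where "H t k = exp (- 2 * real CARD('d) * t) *
        (\<Prod>i\<in>UNIV. bessel_I ((n + (2 * int N + 1) *s k) $ i) (2 * t))" for t k
  define f where "f k t = indicator {0<..} t * (H t k / t powr (1 + s))" for k t
  define q where "q l t = indicator {0<..} t * ((1 - exp (- (t * l))) / t powr (1 + s))" for l t
  define D :: complex where "D = (2 * of_nat N + 1) ^ CARD('d)"
  define F where "F t = (\<Sum>k\<in>index_cube N. (- (unity_char N (idot k n) / D)) * complex_of_real (q (torus_symbol N k) t))" for t
  define J where "J = (\<Sum>k\<in>index_cube N. (- (unity_char N (idot k n) / D)) *
    complex_of_real (\<bar>Gamma (- s)\<bar> * torus_symbol N k powr s))"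
  have J: "J = - \<bar>Gamma (- s)\<bar> * torus_power_kernel N s n"
    unfolding J_def torus_power_kernel_def D_def sum_distrib_left
    by (intro sum.cong) (simp_all add: field_simps)
  have char0: "(\<Sum>k\<in>index_cube N. unity_char N (idot k n)) = 0"
    using n by (simp add: sum_unity_char_index_cube)
  have f_sum: "((\<lambda>k. complex_of_real (f k t)) has_sum F t) UNIV" for t
  proof (cases "0 < t")
    case True
    have "((\<lambda>k. complex_of_real (H t k)) has_sum
       1 / D * (\<Sum>k\<in>index_cube N. of_real (exp (- t * torus_symbol N k)) * unity_char N (idot k n))) UNIV"
      unfolding H_def D_def by (rule torus_heat_kernel_periodization) (use True in simp)
    from has_sum_cmult_right[OF this, of "of_real (1 / t powr (1 + s))"]
    have "((\<lambda>k. complex_of_real (f k t)) has_sum of_real (1 / t powr (1 + s)) *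
       (1 / D * (\<Sum>k\<in>index_cube N. of_real (exp (- t * torus_symbol N k)) * unity_char N (idot k n)))) UNIV"
      using True by (simp add: f_def)
    also have "(\<Sum>k\<in>index_cube N. of_real (exp (- t * torus_symbol N k)) * unity_char N (idot k n)) =
       - (\<Sum>k\<in>index_cube N. of_real (1 - exp (- (t * torus_symbol N k))) * unity_char N (idot k n))"
      using char0 by (simp add: left_diff_distrib sum_subtractf)
    also have "of_real (1 / t powr (1 + s)) * (1 / D * \<dots>) = F t"
      unfolding F_def q_def using True by (simp add: sum_distrib_left sum_negf mult_ac)
    finally show ?thesis .
  qed (simp add: f_def F_def q_def)
  have f_sum_Re: "((\<lambda>k. f k t) has_sum Re (F t)) UNIV" for t
    using has_sum_Re[OF f_sum[of t]] by simp
  \<comment> \<open>As a sum of real terms \<open>F\<close> is real; this lets the exchange of sum and integral run over the reals.\<close>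
  have F_real: "F t = of_real (Re (F t))" for t
    using has_sum_unique[OF f_sum has_sum_of_real[OF f_sum_Re]] .
  have intF: "has_bochner_integral lborel F J"
    unfolding F_def J_def q_def
    by (intro has_bochner_integral_sum has_bochner_integral_mult_right has_bochner_integral_of_real
          has_bochner_integral_frac_power s torus_symbol_nonneg)
  then have intRe: "has_bochner_integral lborel (\<lambda>t. Re (F t)) (Re J)"
    by (rule has_bochner_integral_bounded_linear[OF bounded_linear_Re])
  then have "has_bochner_integral lborel (\<lambda>t. complex_of_real (Re (F t))) (of_real (Re J))"
    by (rule has_bochner_integral_of_real)
  then have "has_bochner_integral lborel F (of_real (Re J))"
    unfolding F_real[symmetric] .
  from has_bochner_integral_eq[OF intF this] have J_real: "J = of_real (Re J)" .
  have "((\<lambda>k. integral\<^sup>L lborel (f k)) has_sum Re J) UNIV"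
  proof (rule has_sum_integral_nonneg[OF _ _ f_sum_Re intRe])
    show "f k \<in> borel_measurable lborel" for k
      unfolding f_def H_def by measurable
    show "0 \<le> f k t" for k t
      unfolding f_def H_def using bessel_I_nonneg[of t]
      by (cases "0 < t") (auto intro!: mult_nonneg_nonneg divide_nonneg_nonneg prod_nonneg)
  qed
  then have "((\<lambda>k. complex_of_real (integral\<^sup>L lborel (f k))) has_sum J) UNIV"
    by (subst J_real) (rule has_sum_of_real)
  from has_sum_cmult_right[OF this, of "of_real (1 / (h powr (2 * s) * \<bar>Gamma (- s)\<bar>))"]
  have "((\<lambda>k. complex_of_real (lattice_kernel h s (n + (2 * int N + 1) *s k))) has_sum
    of_real (1 / (h powr (2 * s) * \<bar>Gamma (- s)\<bar>)) * J) UNIV"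
    unfolding lattice_kernel_def f_def H_def set_lebesgue_integral_def by simp
  also have "of_real (1 / (h powr (2 * s) * \<bar>Gamma (- s)\<bar>)) * J = - torus_power_kernel N s n / of_real (h powr (2 * s))"
  proof -
    have "- s \<notin> \<int>\<^sub>\<le>\<^sub>0" by (rule neg_notin_nonpos_Ints[OF s])
    then show ?thesis by (simp add: J Gamma_eq_zero_iff)
  qed
  finally show ?thesis .
qed

lemma torus_kernel_eq:
  fixes n :: "int ^ 'd"
  assumes s: "0 < s" "s < 1" and n: "n \<notin> range (\<lambda>k. (2 * int N + 1) *s k)"
  shows "(\<lambda>k. lattice_kernel h s (n + (2 * int N + 1) *s k)) summable_on UNIV"
    and "complex_of_real (torus_kernel N h s n) = - torus_power_kernel N s n / of_real (h powr (2 * s))"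
proof -
  note * = lattice_kernel_has_sum[OF assms, of h]
  show sm: "(\<lambda>k. lattice_kernel h s (n + (2 * int N + 1) *s k)) summable_on UNIV"
    using summable_on_Re[OF has_sum_imp_summable[OF *]] by simp
  show "complex_of_real (torus_kernel N h s n) = - torus_power_kernel N s n / of_real (h powr (2 * s))"
    unfolding torus_kernel_def by (rule has_sum_unique[OF has_sum_of_real[OF has_sum_infsum[OF sm]] *])
qed

lemma idot_diff: "idot k (j - m) = idot k j - idot k m"
  by (simp add: idot_def algebra_simps sum_subtractf)

lemma idot_commute: "idot k j = idot j k"
  by (simp add: idot_def mult.commute)

text \<open>The cube is a system of representatives: its coordinates differ by at most \<open>2N < M\<close>.\<close>
lemma diff_index_cube_in_lattice_iff:
  assumes j: "j \<in> index_cube N" and m: "m \<in> index_cube N"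
  shows "j - m \<in> range (\<lambda>k. (2 * int N + 1) *s k) \<longleftrightarrow> j = m"
proof
  assume "j - m \<in> range (\<lambda>k. (2 * int N + 1) *s k)"
  then have dvd: "(2 * int N + 1) dvd (j - m) $ i" for i by (simp only: mem_range_lattice_iff)
  show "j = m"
  proof (rule vec_eq_iff[THEN iffD2], rule allI, rule ccontr)
    fix i assume "j $ i \<noteq> m $ i"
    then have "2 * int N + 1 \<le> \<bar>j $ i - m $ i\<bar>"
      using dvd_imp_le_int[OF _ dvd[of i]] by simp
    moreover have "j $ i \<in> {- int N..int N}" "m $ i \<in> {- int N..int N}"
      using j m by (auto simp: index_cube_def)
    ultimately show False by auto
  qed
next
  assume "j = m"
  then show "j - m \<in> range (\<lambda>k. (2 * int N + 1) *s k)"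
    unfolding mem_range_lattice_iff by simp
qed

text \<open>
  Summing over \<open>m\<close> first, only the frequency \<open>k = 0\<close> survives, and its eigenvalue vanishes. This is the
  statement that the fractional Laplacian annihilates constants.
\<close>
lemma sum_torus_power_kernel:
  fixes j :: "int ^ 'd"
  assumes "0 < s"
  shows "(\<Sum>m\<in>index_cube N. torus_power_kernel N s (j - m)) = 0"
proof -
  have "(\<Sum>m\<in>index_cube N. of_real (torus_symbol N k powr s) * unity_char N (idot k (j - m))) = 0"
    if k: "k \<in> index_cube N" for k :: "int ^ 'd"
  proof -
    have zero: "(0 :: int ^ 'd) \<in> index_cube N" by (simp add: index_cube_def)
    have "(\<Sum>m\<in>index_cube N. of_real (torus_symbol N k powr s) * unity_char N (idot k (j - m)))
      = of_real (torus_symbol N k powr s) * unity_char N (idot k j) * (\<Sum>m\<in>index_cube N. unity_char N (idot m (0 - k)))"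
      unfolding sum_distrib_left
    proof (intro sum.cong refl)
      fix m
      have "idot k (j - m) = idot k j + idot m (0 - k)"
        by (simp add: idot_diff idot_commute[of k m]) (simp add: idot_def sum_negf)
      then show "of_real (torus_symbol N k powr s) * unity_char N (idot k (j - m)) =
        of_real (torus_symbol N k powr s) * unity_char N (idot k j) * unity_char N (idot m (0 - k))"
        by (simp add: unity_char_add)
    qed
    also have "\<dots> = 0"
    proof (cases "k = 0")
      case True
      then show ?thesis by (simp add: torus_symbol_def)
    next
      case False
      then have "0 - k \<notin> range (\<lambda>k. (2 * int N + 1) *s k)"
        using diff_index_cube_in_lattice_iff[OF zero k] by metis
      then show ?thesis by (simp only: sum_unity_char_index_cube if_False mult_zero_right)
    qed
    finally show ?thesis .
  qed
  then have "(\<Sum>k\<in>index_cube N. \<Sum>m\<in>index_cube N. of_real (torus_symbol N k powr s) * unity_char N (idot k (j - m))) = 0"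
    by (rule sum.neutral[OF ballI])
  then have "(\<Sum>m\<in>index_cube N. \<Sum>k\<in>index_cube N. of_real (torus_symbol N k powr s) * unity_char N (idot k (j - m))) = 0"
    by (subst sum.swap)
  then show ?thesis
    unfolding torus_power_kernel_def by (simp add: sum_divide_distrib[symmetric])
qed

lemma torus_frac_laplacian_eq_convolution:
  fixes v :: "real ^ 'd \<Rightarrow> real"
  assumes h: "0 < h"
  shows "torus_frac_laplacian N h s v j =
    (\<Sum>m\<in>index_cube N. of_real (grid_val h v m) * (torus_power_kernel N s (j - m) / of_real (h powr (2 * s))))"
proof -
  define D :: complex where "D = (2 * of_nat N + 1) ^ CARD('d)"
  have sym: "(\<Sum>i\<in>UNIV. 4 / h\<^sup>2 * (sin (real_of_int (k $ i) * pi / (2 * real N + 1)))\<^sup>2) powr s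
    = torus_symbol N k powr s / h powr (2 * s)" for k :: "int ^ 'd"
  proof -
    have "(\<Sum>i\<in>UNIV. 4 / h\<^sup>2 * (sin (real_of_int (k $ i) * pi / (2 * real N + 1)))\<^sup>2) = torus_symbol N k / h\<^sup>2"
      by (simp add: torus_symbol_def sum_divide_distrib)
    moreover have "h\<^sup>2 powr s = h powr (2 * s)"
      using h by (simp add: powr_powr[symmetric])
    ultimately show ?thesis
      using torus_symbol_nonneg[of N k] by (simp add: powr_divide)
  qed
  have e1: "exp (- 2 * of_real pi * \<i> * of_int (idot k m) / (2 * of_nat N + 1)) = unity_char N (- idot k m)" for k m :: "int ^ 'd"
    by (simp add: unity_char_def cis_conv_exp mult_ac)
  have e2: "exp (\<i> * of_int (idot k j) * (2 * of_real pi) / (2 * of_nat N + 1)) = unity_char N (idot k j)" for k :: "int ^ 'd"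
    by (simp add: unity_char_def cis_conv_exp mult_ac)
  have "torus_frac_laplacian N h s v j = (\<Sum>k\<in>index_cube N. \<Sum>m\<in>index_cube N.
     of_real (torus_symbol N k powr s / h powr (2 * s)) * (1 / D * (of_real (grid_val h v m) * unity_char N (- idot k m)))
      * unity_char N (idot k j))"
    unfolding torus_frac_laplacian_def fourier_coeff_def sym e1 e2 D_def[symmetric]
    by (simp only: sum_distrib_left sum_distrib_right)
  also have "\<dots> = (\<Sum>m\<in>index_cube N. \<Sum>k\<in>index_cube N.
     of_real (torus_symbol N k powr s / h powr (2 * s)) * (1 / D * (of_real (grid_val h v m) * unity_char N (- idot k m)))
      * unity_char N (idot k j))"
    by (rule sum.swap)
  also have "\<dots> = (\<Sum>m\<in>index_cube N. of_real (grid_val h v m) * (torus_power_kernel N s (j - m) / of_real (h powr (2 * s))))"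
  proof (intro sum.cong refl)
    fix m
    have "unity_char N (idot k (j - m)) = unity_char N (- idot k m) * unity_char N (idot k j)" for k
      by (simp add: idot_diff unity_char_add[symmetric])
    then show "(\<Sum>k\<in>index_cube N. of_real (torus_symbol N k powr s / h powr (2 * s)) *
        (1 / D * (of_real (grid_val h v m) * unity_char N (- idot k m))) * unity_char N (idot k j)) =
      of_real (grid_val h v m) * (torus_power_kernel N s (j - m) / of_real (h powr (2 * s)))"
      unfolding torus_power_kernel_def D_def[symmetric]
      by (simp add: sum_distrib_left sum_divide_distrib mult_ac)
  qed
  finally show ?thesis .
qed

theorem torus_frac_laplacian_eq_kernel_sum:
  fixes v :: "real ^ 'd \<Rightarrow> real"
  assumes s: "0 < s" "s < 1" and h: "0 < h" and j: "j \<in> index_cube N"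
  shows "torus_frac_laplacian N h s v j =
    of_real (\<Sum>m\<in>index_cube N - {j}. (grid_val h v j - grid_val h v m) * torus_kernel N h s (j - m))"
proof -
  let ?W = "\<lambda>m. torus_power_kernel N s (j - m) / of_real (h powr (2 * s))"
  let ?v = "\<lambda>m. complex_of_real (grid_val h v m)"
  have "(\<Sum>m\<in>index_cube N. ?W m) = 0"
    using sum_torus_power_kernel[OF s(1), of N j] by (simp add: sum_divide_distrib[symmetric])
  then have "torus_frac_laplacian N h s v j = (\<Sum>m\<in>index_cube N. ?v m * ?W m) - ?v j * (\<Sum>m\<in>index_cube N. ?W m)"
    by (simp add: torus_frac_laplacian_eq_convolution[OF h])
  also have "\<dots> = (\<Sum>m\<in>index_cube N. (?v j - ?v m) * (- ?W m))"
    unfolding sum_distrib_left sum_subtractf[symmetric]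
    by (intro sum.cong refl) (simp only: mult_minus_right left_diff_distrib minus_diff_eq)
  also have "\<dots> = (\<Sum>m\<in>index_cube N - {j}. (?v j - ?v m) * (- ?W m))"
    by (rule sum.mono_neutral_right) auto
  also have "\<dots> = (\<Sum>m\<in>index_cube N - {j}. (?v j - ?v m) * of_real (torus_kernel N h s (j - m)))"
  proof (intro sum.cong refl)
    fix m assume "m \<in> index_cube N - {j}"
    then have "j - m \<notin> range (\<lambda>k. (2 * int N + 1) *s k)"
      using diff_index_cube_in_lattice_iff[OF j, of m] by auto
    from torus_kernel_eq(2)[OF s this, of h]
    show "(?v j - ?v m) * (- ?W m) = (?v j - ?v m) * of_real (torus_kernel N h s (j - m))" by simp
  qed
  finally show ?thesis by simp
qed

section \<open>The Poisson integral of the modified Bessel functions\<close>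

text \<open>The density of the symmetric Beta integral \<open>B(a, a)\<close>.\<close>
definition beta_weight :: "real \<Rightarrow> real \<Rightarrow> real" where
  "beta_weight a w = w powr (a - 1) * (1 - w) powr (a - 1)"

lemma beta_weight_nonneg: "0 \<le> beta_weight a w"
  by (simp add: beta_weight_def)

lemma beta_weight_measurable [measurable]: "beta_weight a \<in> borel_measurable borel"
  unfolding beta_weight_def[abs_def] by measurable

lemma set_integrable_beta_weight_times:
  assumes a: "0 < a" and g [measurable]: "g \<in> borel_measurable borel" and bd: "\<And>w. w \<in> {0..1} \<Longrightarrow> \<bar>g w\<bar> \<le> C"
  shows "set_integrable lborel {0..1} (\<lambda>w. beta_weight a w * g w)"
proof -
  have "set_integrable lborel {0..1} (\<lambda>w. beta_weight a w * C)"
    unfolding beta_weight_def using integrable_Beta[OF a a] by (rule set_integrable_mult_left)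
  then show ?thesis
  proof (rule set_integrable_bound)
    show "set_borel_measurable lborel {0..1} (\<lambda>w. beta_weight a w * g w)"
      unfolding set_borel_measurable_def by measurable
    show "AE w in lborel. w \<in> {0..1} \<longrightarrow> norm (beta_weight a w * g w) \<le> norm (beta_weight a w * C)"
    proof (rule AE_I2, rule impI)
      fix w :: real assume "w \<in> {0..1}"
      then have "\<bar>g w\<bar> \<le> \<bar>C\<bar>" using bd[of w] by linarith
      then show "norm (beta_weight a w * g w) \<le> norm (beta_weight a w * C)"
        by (simp add: abs_mult mult_left_mono)
    qed
  qed
qed

definition beta_moment :: "real \<Rightarrow> nat \<Rightarrow> real" where
  "beta_moment a k = (LINT w:{0..1}|lborel. beta_weight a w * (1 - 2 * w) ^ k)"

lemma abs_power_1_minus_2_le: "w \<in> {0..1} \<Longrightarrow> \<bar>(1 - 2 * w) ^ k\<bar> \<le> (1::real)"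
  by (auto simp: power_abs abs_le_iff intro!: power_le_one)

lemma beta_moment_integrable:
  "0 < a \<Longrightarrow> set_integrable lborel {0..1} (\<lambda>w. beta_weight a w * (1 - 2 * w) ^ k)"
  by (rule set_integrable_beta_weight_times[where C = 1]) (use abs_power_1_minus_2_le in auto)

lemma beta_moment_has_integral:
  "0 < a \<Longrightarrow> ((\<lambda>w. beta_weight a w * (1 - 2 * w) ^ k) has_integral beta_moment a k) {0..1}"
  unfolding beta_moment_def set_borel_integral_eq_integral(2)[OF beta_moment_integrable]
  by (intro integrable_integral set_borel_integral_eq_integral(1) beta_moment_integrable)

lemma beta_moment_0: "0 < a \<Longrightarrow> beta_moment a 0 = Beta a a"
  using has_integral_unique[OF beta_moment_has_integral[of a 0] ] has_integral_Beta_real[of a a]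
  by (simp add: beta_weight_def)

text \<open>
  Integrate the derivative of \<open>(w (1 - w))\<^sup>a (1 - 2w)\<^sup>k\<close>, which vanishes at both endpoints, and use
  \<open>4 w (1 - w) = 1 - (1 - 2w)\<^sup>2\<close> to express the result in moments. For \<open>k = 0\<close> the truncated index
  \<open>k - 1\<close> is harmless, since its moment is multiplied by zero.
\<close>
lemma beta_moment_recurrence:
  assumes a: "0 < a"
  shows "(2 * a + real k) * beta_moment a (Suc k) = real k * beta_moment a (k - 1)"
proof -
  define G where "G w = w powr a * (1 - w) powr a * (1 - 2 * w) ^ k" for w :: real
  define G' where "G' w = (a + real k / 2) * (beta_weight a w * (1 - 2 * w) ^ Suc k)
     - real k / 2 * (beta_weight a w * (1 - 2 * w) ^ (k - 1))" for w :: real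
  have "(G has_vector_derivative G' w) (at w)" if w: "w \<in> {0<..<1}" for w
  proof -
    define p q where "p = w powr (a - 1)" and "q = (1 - w) powr (a - 1)"
    have p: "w powr a = w * p" and q: "(1 - w) powr a = (1 - w) * q"
      using w by (simp_all add: p_def q_def powr_diff)
    have "((\<lambda>w. w powr a) has_real_derivative a * p) (at w)"
      unfolding p_def by (rule has_real_derivative_powr) (use w in simp)
    moreover have "((\<lambda>w. (1 - w) powr a) has_real_derivative a * (1 - w) powr (a - of_nat 1) * - 1) (at w)"
      by (rule DERIV_fun_powr) (use w in \<open>auto intro!: derivative_eq_intros\<close>)
    moreover have "((\<lambda>w. (1 - 2 * w) ^ k) has_real_derivative real k * (1 - 2 * w) ^ (k - 1) * - 2) (at w)"
      by (rule derivative_eq_intros refl)+ simp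
    ultimately have "(G has_real_derivative
        (a * p * (1 - w) powr a + a * (1 - w) powr (a - of_nat 1) * - 1 * w powr a) * (1 - 2 * w) ^ k
        + real k * (1 - 2 * w) ^ (k - 1) * - 2 * (w powr a * (1 - w) powr a)) (at w)"
      unfolding G_def by (intro DERIV_mult)
    also have "(a * p * (1 - w) powr a + a * (1 - w) powr (a - of_nat 1) * - 1 * w powr a) * (1 - 2 * w) ^ k
        + real k * (1 - 2 * w) ^ (k - 1) * - 2 * (w powr a * (1 - w) powr a) =
        (a * p * ((1 - w) * q) - a * q * (w * p)) * (1 - 2 * w) ^ k
        - 2 * real k * (1 - 2 * w) ^ (k - 1) * (w * p * ((1 - w) * q))"
      by (simp add: p q q_def[symmetric])
    also have "\<dots> = G' w"
    proof (cases k)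
      case 0
      then show ?thesis by (simp add: G'_def beta_weight_def p_def[symmetric] q_def[symmetric] algebra_simps)
    next
      case (Suc l)
      have "G' w = p * q * (1 - 2 * w) ^ l * ((a + real k / 2) * (1 - 2 * w)\<^sup>2 - real k / 2)"
        unfolding G'_def beta_weight_def p_def[symmetric] q_def[symmetric] Suc
        by (simp add: algebra_simps power2_eq_square)
      also have "(a + real k / 2) * (1 - 2 * w)\<^sup>2 - real k / 2 = a * (1 - 2 * w) * (1 - 2 * w) - 2 * real k * (w * (1 - w))"
        by (simp add: power2_eq_square algebra_simps)
      finally show ?thesis using Suc by (simp add: algebra_simps)
    qed
    finally show ?thesis by (simp add: has_real_derivative_iff_has_vector_derivative)
  qed
  moreover have "continuous_on {0..1} G"
    unfolding G_def using a by (intro continuous_intros continuous_on_powr') auto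
  ultimately have "(G' has_integral (G 1 - G 0)) {0..1}"
    by (intro fundamental_theorem_of_calculus_interior) auto
  moreover have "(G' has_integral ((a + real k / 2) * beta_moment a (Suc k) - real k / 2 * beta_moment a (k - 1))) {0..1}"
    unfolding G'_def
    by (intro has_integral_diff has_integral_mult_right beta_moment_has_integral a)
  ultimately have "(a + real k / 2) * beta_moment a (Suc k) - real k / 2 * beta_moment a (k - 1) = G 1 - G 0"
    by (rule has_integral_unique[rotated])
  also have "G 1 - G 0 = 0" by (simp add: G_def)
  finally show ?thesis by (simp add: algebra_simps)
qed

lemma beta_moment_odd: "0 < a \<Longrightarrow> beta_moment a (2 * n + 1) = 0"
proof (induction n)
  case 0
  then show ?case using beta_moment_recurrence[of a 0] by simp
next
  case (Suc n)
  then show ?case using beta_moment_recurrence[of a "2 * n + 2"] by (simp add: add_eq_0_iff)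
qed

text \<open>
  For \<open>a = m + 1/2\<close> the recurrence has the coefficient ratio of the Bessel series, so that the even
  moments divided by \<open>(2n)!\<close> are the Bessel coefficients of order \<open>m\<close> up to a factor free of \<open>n\<close>.
\<close>
lemma beta_moment_even:
  "beta_moment (real m + 1 / 2) (2 * n) / fact (2 * n) =
    Beta (real m + 1 / 2) (real m + 1 / 2) * fact m / (4 ^ n * fact n * fact (n + m))"
proof (induction n)
  case 0
  then show ?case by (simp add: beta_moment_0)
next
  case (Suc n)
  let ?b = "beta_moment (real m + 1 / 2)"
  have "(2 * (real m + 1 / 2) + real (2 * n + 1)) * ?b (Suc (2 * n + 1)) = real (2 * n + 1) * ?b (2 * n + 1 - 1)"
    by (rule beta_moment_recurrence) simp
  then have b: "?b (2 * Suc n) = (2 * real n + 1) / (2 * (real n + real m + 1)) * ?b (2 * n)"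
    by (simp add: field_simps)
  have f: "fact (2 * Suc n) = (2 * real n + 2) * (2 * real n + 1) * fact (2 * n)"
    by (simp add: algebra_simps)
  have "?b (2 * Suc n) / fact (2 * Suc n) =
      (2 * real n + 1) * ?b (2 * n) / (2 * (real n + real m + 1) * ((2 * real n + 2) * (2 * real n + 1) * fact (2 * n)))"
    unfolding b f by (simp only: times_divide_eq_left divide_divide_eq_left)
  also have "\<dots> = ?b (2 * n) / fact (2 * n) / (4 * (real n + real m + 1) * (real n + 1))"
  proof -
    have "c * b / (p * (r * c * F)) = b / F / (p * r)" if "c \<noteq> 0" for b c p r F :: real
      using that by simp
    note cancel = this
    have nz: "2 * real n + 1 \<noteq> 0" by linarith
    have eq: "2 * (real n + real m + 1) * (2 * real n + 2) = 4 * (real n + real m + 1) * (real n + 1)"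
      by (simp add: algebra_simps)
    show ?thesis unfolding eq[symmetric] by (rule cancel[OF nz])
  qed
  also have "\<dots> = Beta (real m + 1 / 2) (real m + 1 / 2) * fact m / (4 ^ n * fact n * fact (n + m)) / (4 * (real n + real m + 1) * (real n + 1))"
    unfolding Suc.IH ..
  also have "\<dots> = Beta (real m + 1 / 2) (real m + 1 / 2) * fact m / (4 ^ Suc n * fact (Suc n) * fact (Suc n + m))"
    by (simp add: algebra_simps)
  finally show ?case .
qed

text \<open>
  Expand the exponential and integrate termwise: the odd moments vanish and the even ones reproduce
  the Bessel series.
\<close>
lemma bessel_I_Poisson_integral:
  assumes t: "0 < t"
  shows "set_integrable lborel {0..1} (\<lambda>w. beta_weight (real m + 1 / 2) w * exp (2 * t * (1 - 2 * w)))"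
    and "t ^ m * (LINT w:{0..1}|lborel. beta_weight (real m + 1 / 2) w * exp (2 * t * (1 - 2 * w))) =
      Beta (real m + 1 / 2) (real m + 1 / 2) * fact m * bessel_I (int m) (2 * t)"
proof -
  let ?a = "real m + 1 / 2"
  let ?B = "Beta ?a ?a"
  have a: "0 < ?a" by simp
  have le: "exp (2 * t * (1 - 2 * w)) \<le> exp (2 * t)" if "w \<in> {0..1}" for w
    using t that by simp
  show int: "set_integrable lborel {0..1} (\<lambda>w. beta_weight ?a w * exp (2 * t * (1 - 2 * w)))"
    by (rule set_integrable_beta_weight_times[where C = "exp (2 * t)"]) (use le in auto)
  define g where "g k w = indicator {0..1} w * (beta_weight ?a w * (1 - 2 * w) ^ k) * ((2 * t) ^ k / fact k)"
    for k and w :: real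
  have gint: "has_bochner_integral lborel (g k) (beta_moment ?a k * ((2 * t) ^ k / fact k))" for k
    using beta_moment_integrable[OF a, of k] unfolding g_def beta_moment_def set_lebesgue_integral_def set_integrable_def
    by (intro has_bochner_integral_mult_left) (simp add: has_bochner_integral_iff)
  have gsums: "(\<lambda>k. g k w) sums (indicator {0..1} w * (beta_weight ?a w * exp (2 * t * (1 - 2 * w))))" for w
  proof -
    have "(\<lambda>k. indicator {0..1} w * beta_weight ?a w * ((2 * t * (1 - 2 * w)) ^ k /\<^sub>R fact k)) sums
       (indicator {0..1} w * beta_weight ?a w * exp (2 * t * (1 - 2 * w)))"
      by (intro sums_mult exp_converges)
    moreover have "indicator {0..1} w * beta_weight ?a w * ((2 * t * (1 - 2 * w)) ^ k /\<^sub>R fact k) = g k w" for k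
      unfolding power_mult_distrib[of "2 * t"] g_def real_scaleR_def divide_inverse by (simp only: mult_ac)
    ultimately show ?thesis by (simp only: mult.assoc)
  qed
  have gnorm: "norm (g k w) \<le> indicator {0..1} w * beta_weight ?a w * ((2 * t) ^ k / fact k)" for k w
  proof (cases "w \<in> {0..1}")
    case True
    have "norm (g k w) = beta_weight ?a w * ((2 * t) ^ k / fact k) * \<bar>(1 - 2 * w) ^ k\<bar>"
      using True t beta_weight_nonneg[of ?a w] by (simp add: g_def abs_mult)
    also have "\<dots> \<le> beta_weight ?a w * ((2 * t) ^ k / fact k) * 1"
      using t by (intro mult_left_mono abs_power_1_minus_2_le[OF True] mult_nonneg_nonneg beta_weight_nonneg) auto
    finally show ?thesis using True by simp
  qed (simp add: g_def)
  have sm: "summable (\<lambda>k. (2 * t) ^ k / fact k)"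
    using summable_exp[of "2 * t"] by (simp add: field_simps)
  have "(\<lambda>k. integral\<^sup>L lborel (g k)) sums (\<integral>w. (\<Sum>k. g k w) \<partial>lborel)"
  proof (rule sums_integral)
    show "integrable lborel (g k)" for k using gint by (auto simp: has_bochner_integral_iff)
    show "AE w in lborel. summable (\<lambda>k. norm (g k w))"
      by (rule AE_I2, rule summable_comparison_test[OF _ summable_mult[OF sm]]) (use gnorm in auto)
    show "summable (\<lambda>k. \<integral>w. norm (g k w) \<partial>lborel)"
    proof (rule summable_comparison_test[OF _ summable_mult[OF sm, of "beta_moment ?a 0"]], intro exI allI impI)
      fix k :: nat
      have "(\<integral>w. norm (g k w) \<partial>lborel) \<le> (\<integral>w. indicator {0..1} w * beta_weight ?a w * ((2 * t) ^ k / fact k) \<partial>lborel)"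
        using gint[of k] beta_moment_integrable[OF a, of 0] gnorm
        by (intro integral_mono) (auto simp: has_bochner_integral_iff set_integrable_def)
      also have "\<dots> = beta_moment ?a 0 * ((2 * t) ^ k / fact k)"
        by (simp add: beta_moment_def set_lebesgue_integral_def)
      finally show "norm (\<integral>w. norm (g k w) \<partial>lborel) \<le> beta_moment ?a 0 * ((2 * t) ^ k / fact k)"
        by simp
    qed
  qed
  then have "(\<lambda>k. beta_moment ?a k * ((2 * t) ^ k / fact k)) sums
      (LINT w:{0..1}|lborel. beta_weight ?a w * exp (2 * t * (1 - 2 * w)))"
    using gint gsums by (simp add: has_bochner_integral_iff sums_iff set_lebesgue_integral_def)
  then have "(\<lambda>n. beta_moment ?a (2 * n) * ((2 * t) ^ (2 * n) / fact (2 * n))) sums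
      (LINT w:{0..1}|lborel. beta_weight ?a w * exp (2 * t * (1 - 2 * w)))"
  proof (subst sums_mono_reindex)
    show "strict_mono (\<lambda>n::nat. 2 * n)" by (simp add: strict_mono_def)
    fix k assume "k \<notin> range (\<lambda>n::nat. 2 * n)"
    then have "odd k" by (auto elim!: evenE)
    then obtain n where "k = 2 * n + 1" by (auto elim: oddE)
    then show "beta_moment ?a k * ((2 * t) ^ k / fact k) = 0" using beta_moment_odd[OF a, of n] by simp
  qed
  then have S1: "(\<lambda>n. t ^ m * (beta_moment ?a (2 * n) * ((2 * t) ^ (2 * n) / fact (2 * n)))) sums
      (t ^ m * (LINT w:{0..1}|lborel. beta_weight ?a w * exp (2 * t * (1 - 2 * w))))"
    by (rule sums_mult)
  have eq: "(\<lambda>n. t ^ m * (beta_moment ?a (2 * n) * ((2 * t) ^ (2 * n) / fact (2 * n)))) =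
     (\<lambda>n. ?B * fact m * (t ^ (2 * n + m) / (fact (n + m) * fact n)))"
  proof
    fix n
    have "t ^ m * (beta_moment ?a (2 * n) * ((2 * t) ^ (2 * n) / fact (2 * n))) =
      t ^ m * (2 * t) ^ (2 * n) * (beta_moment ?a (2 * n) / fact (2 * n))" by simp
    also have "\<dots> = ?B * fact m * (t ^ (2 * n + m) / (fact (n + m) * fact n))"
    proof -
      have e: "(2 * t) ^ (2 * n) = 4 ^ n * t ^ (2 * n)"
        by (simp add: power_mult_distrib power_mult)
      show ?thesis
        unfolding e beta_moment_even by (simp add: power_add mult_ac)
    qed
    finally show "t ^ m * (beta_moment ?a (2 * n) * ((2 * t) ^ (2 * n) / fact (2 * n))) =
      ?B * fact m * (t ^ (2 * n + m) / (fact (n + m) * fact n))" .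
  qed
  have S2: "(\<lambda>n. ?B * fact m * (t ^ (2 * n + m) / (fact (n + m) * fact n))) sums (?B * fact m * bessel_I (int m) (2 * t))"
    using sums_mult[OF has_sum_imp_sums[OF bessel_I_has_sum[of t "int m"]]] t by simp
  show "t ^ m * (LINT w:{0..1}|lborel. beta_weight ?a w * exp (2 * t * (1 - 2 * w))) =
      ?B * fact m * bessel_I (int m) (2 * t)"
    by (rule sums_unique2[OF S1[unfolded eq] S2])
qed

section \<open>The lattice kernel in dimension one\<close>

text \<open>Legendre's duplication formula at half-integers.\<close>
lemma Gamma_half_plus_nat: "Gamma (real m + 1 / 2) * fact m * 4 ^ m = sqrt pi * fact (2 * m)"
proof (induction m)
  case 0
  then show ?case by (simp add: Gamma_one_half_real)
next
  case (Suc m)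
  have "real m + 1 / 2 \<notin> \<int>\<^sub>\<le>\<^sub>0" by (auto elim!: nonpos_Ints_cases)
  then have g: "Gamma (real (Suc m) + 1 / 2) = (real m + 1 / 2) * Gamma (real m + 1 / 2)"
    using Gamma_plus1[of "real m + 1 / 2"] by (simp add: add_ac)
  have f: "fact (2 * Suc m) = (2 * real m + 2) * (2 * real m + 1) * fact (2 * m)"
    by (simp add: algebra_simps)
  have "Gamma (real (Suc m) + 1 / 2) * fact (Suc m) * 4 ^ Suc m =
    (real m + 1 / 2) * (real m + 1) * 4 * (Gamma (real m + 1 / 2) * fact m * 4 ^ m)"
    unfolding g by (simp add: mult_ac)
  also have "\<dots> = (real m + 1 / 2) * (real m + 1) * 4 * (sqrt pi * fact (2 * m))"
    unfolding Suc.IH ..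
  also have "(real m + 1 / 2) * (real m + 1) * 4 = (2 * real m + 2) * (2 * real m + 1)"
    by (simp add: algebra_simps)
  also have "(2 * real m + 2) * (2 * real m + 1) * (sqrt pi * fact (2 * m)) = sqrt pi * fact (2 * Suc m)"
    unfolding f by (simp only: mult_ac)
  finally show ?case .
qed

text \<open>
  The constant left over in the computation of the one-dimensional kernel: the denominator comes
  from the normalization of the Poisson integral, the numerator from its final \<open>w\<close>-integral.
\<close>
lemma Beta_quotient:
  assumes "0 < s"
  shows "Beta (s + 1 / 2) (real m + 1 / 2) / (Beta (real m + 1 / 2) (real m + 1 / 2) * fact m) =
    4 ^ m * Gamma (1 / 2 + s) / (sqrt pi * Gamma (real m + 1 + s))"
proof -
  define g where "g = Gamma (real m + 1 / 2)"
  have g: "0 < g" by (simp add: g_def Gamma_real_pos)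
  have "Gamma (2 * real m + 1) = fact (2 * m)"
    using Gamma_fact[of "2 * m"] by (simp add: add_ac)
  then have B: "Beta (real m + 1 / 2) (real m + 1 / 2) = g * g / fact (2 * m)"
    by (simp add: Beta_def g_def mult_2[symmetric])
  have B': "Beta (s + 1 / 2) (real m + 1 / 2) = Gamma (1 / 2 + s) * g / Gamma (real m + 1 + s)"
    by (simp add: Beta_def g_def add_ac)
  have "g * fact m * 4 ^ m = sqrt pi * fact (2 * m)"
    unfolding g_def by (rule Gamma_half_plus_nat)
  then have "fact (2 * m) / (g * fact m) = 4 ^ m / sqrt pi"
    using g by (simp add: field_simps)
  moreover have "Beta (s + 1 / 2) (real m + 1 / 2) / (Beta (real m + 1 / 2) (real m + 1 / 2) * fact m) =
    Gamma (1 / 2 + s) / Gamma (real m + 1 + s) * (fact (2 * m) / (g * fact m))"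
    unfolding B B' using g by simp
  ultimately show ?thesis by (simp add: mult_ac)
qed

text \<open>
  Insert the Poisson integral, \<open>e\<^sup>-\<^sup>2\<^sup>t e\<^bsup>2t(1 - 2w)\<^esup> = e\<^bsup>-4tw\<^esup>\<close>, and exchange the integrals. The
  \<open>t\<close>-integral gives \<open>\<Gamma>(m-s) (4w)\<^bsup>s-m\<^esup>\<close>, which converges because \<open>m \<ge> 1 > s\<close>; the powers of \<open>w\<close> then
  combine to the integrand of \<open>B(s + 1/2, m + 1/2)\<close>.
\<close>
lemma nn_integral_bessel_I_frac:
  assumes s: "0 < s" "s < 1" and m: "1 \<le> m"
  shows "(\<integral>\<^sup>+t. ennreal (indicator {0<..} t * (exp (- 2 * t) * bessel_I (int m) (2 * t) / t powr (1 + s))) \<partial>lborel) =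
    ennreal (4 powr s * Gamma (1 / 2 + s) / sqrt pi * (Gamma (real m - s) / Gamma (real m + 1 + s)))"
proof -
  let ?a = "real m + 1 / 2"
  define C where "C = Beta ?a ?a * fact m"
  have C: "0 < C" unfolding C_def Beta_def by (auto intro!: mult_pos_pos divide_pos_pos Gamma_real_pos)
  let ?h = "\<lambda>t w. ennreal (indicator {0..1} w * (beta_weight ?a w / C) *
     (indicator {0<..} t * (t powr ((real m - s) - 1) * exp (- (4 * w * t)))))"
  have "(\<integral>\<^sup>+t. ennreal (indicator {0<..} t * (exp (- 2 * t) * bessel_I (int m) (2 * t) / t powr (1 + s))) \<partial>lborel) =
    (\<integral>\<^sup>+t. (\<integral>\<^sup>+w. ?h t w \<partial>lborel) \<partial>lborel)"
  proof (intro nn_integral_cong)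
    fix t :: real
    show "ennreal (indicator {0<..} t * (exp (- 2 * t) * bessel_I (int m) (2 * t) / t powr (1 + s))) =
      (\<integral>\<^sup>+w. ?h t w \<partial>lborel)"
    proof (cases "0 < t")
      case True
      let ?q = "\<lambda>w. indicator {0..1} w *\<^sub>R (beta_weight ?a w * exp (2 * t * (1 - 2 * w)))"
      define c where "c = t powr ((real m - s) - 1) * exp (- 2 * t) / C"
      have c: "0 \<le> c" using C by (simp add: c_def)
      have h: "?h t w = ennreal (c * ?q w)" for w
      proof -
        have "exp (- (4 * w * t)) = exp (- 2 * t) * exp (2 * t * (1 - 2 * w))"
          unfolding exp_add[symmetric] by (simp add: algebra_simps)
        then show ?thesis using True by (simp add: c_def mult_ac)
      qed
      have "integrable lborel ?q"
        using bessel_I_Poisson_integral(1)[OF True, of m] by (simp add: set_integrable_def)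
      then have "(\<integral>\<^sup>+w. ?h t w \<partial>lborel) = ennreal (\<integral>w. c * ?q w \<partial>lborel)"
        unfolding h by (intro nn_integral_eq_integral) (auto intro!: mult_nonneg_nonneg c beta_weight_nonneg)
      also have "(\<integral>w. c * ?q w \<partial>lborel) = c * (LINT w:{0..1}|lborel. beta_weight ?a w * exp (2 * t * (1 - 2 * w)))"
        unfolding set_lebesgue_integral_def by (rule integral_mult_right_zero)
      also have "\<dots> = c * (C * bessel_I (int m) (2 * t) / t ^ m)"
        using bessel_I_Poisson_integral(2)[OF True, of m] True by (simp add: C_def field_simps)
      also have "\<dots> = exp (- 2 * t) * bessel_I (int m) (2 * t) / t powr (1 + s)"
      proof -
        have "t powr ((real m - s) - 1) = t ^ m / t powr (1 + s)"
          using True by (simp add: powr_diff powr_add powr_realpow)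
        then show ?thesis using C True by (simp add: c_def)
      qed
      finally show ?thesis using True by simp
    qed simp
  qed
  also have "\<dots> = (\<integral>\<^sup>+w. (\<integral>\<^sup>+t. ?h t w \<partial>lborel) \<partial>lborel)"
    by (rule lborel_pair.Fubini'[symmetric]) measurable
  also have "\<dots> = (\<integral>\<^sup>+w. ennreal (indicator {0..1} w *
      (Gamma (real m - s) * 4 powr (s - real m) / C * (w powr ((s + 1 / 2) - 1) * (1 - w) powr (?a - 1)))) \<partial>lborel)"
  proof (rule nn_integral_cong_AE)
    show "AE w in lborel. (\<integral>\<^sup>+t. ?h t w \<partial>lborel) = ennreal (indicator {0..1} w *
      (Gamma (real m - s) * 4 powr (s - real m) / C * (w powr ((s + 1 / 2) - 1) * (1 - w) powr (?a - 1))))"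
      using AE_lborel_singleton[of 0]
    proof eventually_elim
      fix w :: real assume w: "w \<noteq> 0"
      show "(\<integral>\<^sup>+t. ?h t w \<partial>lborel) = ennreal (indicator {0..1} w *
        (Gamma (real m - s) * 4 powr (s - real m) / C * (w powr ((s + 1 / 2) - 1) * (1 - w) powr (?a - 1))))"
      proof (cases "w \<in> {0..1}")
        case True
        then have w0: "0 < w" using w by simp
        have "(\<integral>\<^sup>+t. ?h t w \<partial>lborel) = (\<integral>\<^sup>+t. ennreal (beta_weight ?a w / C) *
          ennreal (indicator {0<..} t * (t powr ((real m - s) - 1) * exp (- (4 * w * t)))) \<partial>lborel)"
          using True C by (intro nn_integral_cong, subst ennreal_mult'[symmetric]) (auto intro!: divide_nonneg_nonneg beta_weight_nonneg)
        also have "\<dots> = ennreal (beta_weight ?a w / C) *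
          (\<integral>\<^sup>+t. ennreal (indicator {0<..} t * (t powr ((real m - s) - 1) * exp (- (4 * w * t)))) \<partial>lborel)"
          by (rule nn_integral_cmult) measurable
        also have "(\<integral>\<^sup>+t. ennreal (indicator {0<..} t * (t powr ((real m - s) - 1) * exp (- (4 * w * t)))) \<partial>lborel) =
           ennreal (Gamma (real m - s) / (4 * w) powr (real m - s))"
          by (rule nn_integral_Gamma_scaled) (use m s w0 in auto)
        also have "ennreal (beta_weight ?a w / C) * ennreal (Gamma (real m - s) / (4 * w) powr (real m - s)) =
           ennreal (beta_weight ?a w / C * (Gamma (real m - s) / (4 * w) powr (real m - s)))"
          using C by (intro ennreal_mult'[symmetric] divide_nonneg_nonneg beta_weight_nonneg) simp
        also have "beta_weight ?a w / C * (Gamma (real m - s) / (4 * w) powr (real m - s)) =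
           Gamma (real m - s) * 4 powr (s - real m) / C * (w powr ((s + 1 / 2) - 1) * (1 - w) powr (?a - 1))"
        proof -
          have "w powr ((s + 1 / 2) - 1) = w powr ((?a - 1) + (s - real m))" by (simp add: algebra_simps)
          also have "\<dots> = w powr (?a - 1) * w powr (s - real m)" by (rule powr_add)
          finally have 1: "w powr ((s + 1 / 2) - 1) = w powr (?a - 1) * w powr (s - real m)" .
          have "inverse ((4 * w) powr (real m - s)) = (4 * w) powr (s - real m)"
            using powr_minus[of "4 * w" "real m - s"] by simp
          also have "\<dots> = 4 powr (s - real m) * w powr (s - real m)"
            using w0 by (simp add: powr_mult)
          finally have 2: "Gamma (real m - s) / (4 * w) powr (real m - s) =
              Gamma (real m - s) * (4 powr (s - real m) * w powr (s - real m))"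
            by (simp only: divide_inverse)
          show ?thesis unfolding beta_weight_def 1 2
            by (simp only: times_divide_eq_left times_divide_eq_right mult_ac)
        qed
        finally show ?thesis using True by simp
      qed simp
    qed
  qed
  also have "\<dots> = ennreal (Gamma (real m - s) * 4 powr (s - real m) / C * Beta (s + 1 / 2) ?a)"
  proof (rule nn_integral_has_integral_lebesgue)
    show "((\<lambda>w. Gamma (real m - s) * 4 powr (s - real m) / C * (w powr ((s + 1 / 2) - 1) * (1 - w) powr (?a - 1)))
      has_integral Gamma (real m - s) * 4 powr (s - real m) / C * Beta (s + 1 / 2) ?a) {0..1}"
      by (intro has_integral_mult_right has_integral_Beta_real) (use s in auto)
    show "0 \<le> Gamma (real m - s) * 4 powr (s - real m) / C * (w powr ((s + 1 / 2) - 1) * (1 - w) powr (?a - 1))" for w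
      using C m s Gamma_real_pos[of "real m - s"] by (intro mult_nonneg_nonneg divide_nonneg_nonneg) auto
  qed
  also have "Gamma (real m - s) * 4 powr (s - real m) / C * Beta (s + 1 / 2) ?a =
    Gamma (real m - s) * 4 powr (s - real m) * (Beta (s + 1 / 2) ?a / (Beta ?a ?a * fact m))"
    by (simp add: C_def)
  also have "\<dots> = Gamma (real m - s) * 4 powr (s - real m) * (4 ^ m * Gamma (1 / 2 + s) / (sqrt pi * Gamma (real m + 1 + s)))"
    unfolding Beta_quotient[OF s(1)] ..
  also have "\<dots> = 4 powr s * Gamma (1 / 2 + s) / sqrt pi * (Gamma (real m - s) / Gamma (real m + 1 + s))"
    by (simp add: powr_diff powr_realpow)
  finally show ?thesis .
qed

lemma lattice_kernel_1d:
  assumes s: "0 < s" "s < 1" and j: "j \<noteq> 0"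
  shows "lattice_kernel h s (vec j :: int ^ 1) =
    4 powr s * Gamma (1 / 2 + s) / (h powr (2 * s) * sqrt pi * \<bar>Gamma (- s)\<bar>) *
    (Gamma (real_of_int \<bar>j\<bar> - s) / Gamma (real_of_int \<bar>j\<bar> + 1 + s))"
proof -
  define m where "m = nat \<bar>j\<bar>"
  have m: "1 \<le> m" and j': "real_of_int \<bar>j\<bar> = real m" using j by (auto simp: m_def)
  have I: "bessel_I j = bessel_I (int m)"
    unfolding m_def by (cases j rule: int_cases2) (auto simp: bessel_I_minus[abs_def])
  let ?K = "4 powr s * Gamma (1 / 2 + s) / sqrt pi * (Gamma (real m - s) / Gamma (real m + 1 + s))"
  have "has_bochner_integral lborel
    (\<lambda>t. indicator {0<..} t * (exp (- 2 * t) * bessel_I (int m) (2 * t) / t powr (1 + s))) ?K"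
  proof (rule has_bochner_integral_nn_integral[OF _ _ _ nn_integral_bessel_I_frac[OF s m]])
    show "AE t in lborel. 0 \<le> indicator {0<..} t * (exp (- 2 * t) * bessel_I (int m) (2 * t) / t powr (1 + s))"
      by (auto simp: indicator_def intro!: divide_nonneg_nonneg mult_nonneg_nonneg bessel_I_nonneg)
    show "0 \<le> ?K"
      using s m by (intro mult_nonneg_nonneg divide_nonneg_nonneg) (auto intro!: less_imp_le Gamma_real_pos)
  qed measurable
  then have "(LINT t:{0<..}|lborel. exp (- 2 * t) * bessel_I (int m) (2 * t) / t powr (1 + s)) = ?K"
    by (simp add: has_bochner_integral_iff set_lebesgue_integral_def)
  then show ?thesis
    by (simp add: lattice_kernel_def I j'[unfolded of_int_abs] mult_ac)
qed

section \<open>The representation theorem\<close>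

lemma bij_vec_1: "bij (vec :: 'a \<Rightarrow> 'a ^ 1)"
  by (rule bij_betwI[where g = "\<lambda>x. x $ 1"]) (auto simp: vec_eq_iff)

lemma vec_1_in_lattice_iff: "(vec j :: int ^ 1) \<in> range (\<lambda>k. M *s k) \<longleftrightarrow> j \<in> range (\<lambda>k. M * k)"
  unfolding mem_range_lattice_iff by (auto simp: dvd_def)

lemma torus_frac_laplacian_1d:
  fixes v :: "real \<Rightarrow> real"
  assumes s: "0 < s" "s < 1" and h: "0 < h" and j: "j \<in> {- int N..int N}"
  shows "torus_frac_laplacian N h s (\<lambda>x :: real ^ 1. v (x $ 1)) (vec j) =
    of_real (\<Sum>m \<in> {- int N..int N} - {j}.
      (v (h * real_of_int j) - v (h * real_of_int m)) * torus_kernel N h s (vec (j - m) :: int ^ 1))"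
proof -
  let ?v = "\<lambda>x :: real ^ 1. v (x $ 1)"
  have "(vec j :: int ^ 1) \<in> index_cube N" using j by (simp add: index_cube_def)
  from torus_frac_laplacian_eq_kernel_sum[OF s h this, of ?v]
  have "torus_frac_laplacian N h s ?v (vec j) = of_real (\<Sum>m\<in>index_cube N - {vec j}.
    (grid_val h ?v (vec j) - grid_val h ?v m) * torus_kernel N h s (vec j - m))" .
  also have "(\<Sum>m\<in>index_cube N - {vec j}. (grid_val h ?v (vec j) - grid_val h ?v m) * torus_kernel N h s (vec j - m)) =
    (\<Sum>m \<in> {- int N..int N} - {j}.
      (v (h * real_of_int j) - v (h * real_of_int m)) * torus_kernel N h s (vec (j - m) :: int ^ 1))"
  proof (rule sum.reindex_bij_witness[where i = vec and j = "\<lambda>x. x $ 1"])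
    show "(v (h * real_of_int j) - v (h * real_of_int (m $ 1))) * torus_kernel N h s (vec (j - m $ 1) :: int ^ 1) =
       (grid_val h ?v (vec j) - grid_val h ?v m) * torus_kernel N h s (vec j - m)" for m :: "int ^ 1"
    proof -
      have "vec (j - m $ 1) = vec j - m" by (simp add: vec_eq_iff)
      then show ?thesis by (simp add: grid_val_def)
    qed
  qed (auto simp: index_cube_def vec_eq_iff)
  finally show ?thesis .
qed

text \<open>
  The series of Gamma quotients is a nonzero multiple of the lattice kernel series, and so inherits
  its convergence. No index \<open>j + kM\<close> is zero because \<open>j\<close> is not a multiple of \<open>M\<close>.
\<close>
lemma torus_kernel_1d:
  fixes j :: int
  assumes s: "0 < s" "s < 1" and h: "0 < h" and j: "j \<notin> range (\<lambda>k. (2 * int N + 1) * k)"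
  shows "(\<lambda>k :: int. Gamma (real_of_int \<bar>j + k * (2 * int N + 1)\<bar> - s) /
          Gamma (real_of_int \<bar>j + k * (2 * int N + 1)\<bar> + 1 + s)) summable_on UNIV"
    and "torus_kernel N h s (vec j :: int ^ 1) =
       4 powr s * Gamma (1 / 2 + s) / (h powr (2 * s) * sqrt pi * \<bar>Gamma (- s)\<bar>) *
       (\<Sum>\<^sub>\<infinity>k\<in>(UNIV :: int set). Gamma (real_of_int \<bar>j + k * (2 * int N + 1)\<bar> - s) /
          Gamma (real_of_int \<bar>j + k * (2 * int N + 1)\<bar> + 1 + s))"
proof -
  let ?r = "\<lambda>k :: int. Gamma (real_of_int \<bar>j + k * (2 * int N + 1)\<bar> - s) /
          Gamma (real_of_int \<bar>j + k * (2 * int N + 1)\<bar> + 1 + s)"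
  let ?L = "\<lambda>k :: int ^ 1. lattice_kernel h s (vec j + (2 * int N + 1) *s k)"
  define c where "c = 4 powr s * Gamma (1 / 2 + s) / (h powr (2 * s) * sqrt pi * \<bar>Gamma (- s)\<bar>)"
  have "- s \<notin> \<int>\<^sub>\<le>\<^sub>0" by (rule neg_notin_nonpos_Ints[OF s])
  then have "c \<noteq> 0"
    using h s Gamma_real_pos[of "1 / 2 + s"] by (auto simp: c_def Gamma_eq_zero_iff)
  have L: "?L (vec k) = c * ?r k" for k
  proof -
    have nz: "j + k * (2 * int N + 1) \<noteq> 0"
    proof
      assume "j + k * (2 * int N + 1) = 0"
      then have "j = (2 * int N + 1) * (- k)" by (simp add: algebra_simps)
      then show False using j by blast
    qed
    have eq: "vec j + (2 * int N + 1) *s vec k = (vec (j + k * (2 * int N + 1)) :: int ^ 1)"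
      by (simp add: vec_eq_iff algebra_simps)
    show ?thesis
      unfolding c_def eq by (rule lattice_kernel_1d[OF s nz])
  qed
  have n: "(vec j :: int ^ 1) \<notin> range (\<lambda>k. (2 * int N + 1) *s k)"
    using j by (simp only: vec_1_in_lattice_iff not_False_eq_True)
  have "(?L has_sum torus_kernel N h s (vec j :: int ^ 1)) UNIV"
    unfolding torus_kernel_def by (rule has_sum_infsum[OF torus_kernel_eq(1)[OF s n]])
  then have "((\<lambda>k. ?L (vec k)) has_sum torus_kernel N h s (vec j :: int ^ 1)) UNIV"
    by (subst has_sum_reindex_bij_betw[OF bij_vec_1])
  then have *: "((\<lambda>k. c * ?r k) has_sum torus_kernel N h s (vec j :: int ^ 1)) UNIV"
    by (simp only: L)
  from has_sum_cmult_right[OF this, of "1 / c"] \<open>c \<noteq> 0\<close>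
  have "(?r has_sum torus_kernel N h s (vec j :: int ^ 1) / c) UNIV" by simp
  then show "?r summable_on UNIV" and "torus_kernel N h s (vec j :: int ^ 1) =
       4 powr s * Gamma (1 / 2 + s) / (h powr (2 * s) * sqrt pi * \<bar>Gamma (- s)\<bar>) * (\<Sum>\<^sub>\<infinity>k\<in>UNIV. ?r k)"
    using \<open>c \<noteq> 0\<close> by (auto simp: has_sum_iff c_def[symmetric])
qed

theorem theorem7:
  fixes s h :: real and N :: nat
  assumes "0 < s" and "s < 1" and "h = 2 * pi / (2 * real N + 1)"
  shows
   "(\<forall>j :: int ^ 'd. j \<notin> range (\<lambda>k. (2 * int N + 1) *s k) \<longrightarrow>
       (\<lambda>k. lattice_kernel h s (j + (2 * int N + 1) *s k)) summable_on UNIV) \<and>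
    (\<forall>v :: real ^ 'd \<Rightarrow> real. \<forall>j \<in> index_cube N.
       torus_frac_laplacian N h s v j =
       of_real (\<Sum>m \<in> index_cube N - {j}.
         (grid_val h v j - grid_val h v m) * torus_kernel N h s (j - m))) \<and>
    (\<forall>v :: real \<Rightarrow> real. \<forall>j \<in> {- int N..int N}.
       torus_frac_laplacian N h s (\<lambda>x :: real ^ 1. v (x $ 1)) (vec j) =
       of_real (\<Sum>m \<in> {- int N..int N} - {j}.
         (v (h * real_of_int j) - v (h * real_of_int m)) *
           torus_kernel N h s (vec (j - m) :: int ^ 1))) \<and>
    (\<forall>j :: int. j \<notin> range (\<lambda>k. (2 * int N + 1) * k) \<longrightarrow>
       (\<lambda>k :: int. Gamma (real_of_int \<bar>j + k * (2 * int N + 1)\<bar> - s) /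
          Gamma (real_of_int \<bar>j + k * (2 * int N + 1)\<bar> + 1 + s)) summable_on UNIV \<and>
       torus_kernel N h s (vec j :: int ^ 1) =
       4 powr s * Gamma (1 / 2 + s) / (h powr (2 * s) * sqrt pi * \<bar>Gamma (- s)\<bar>) *
       (\<Sum>\<^sub>\<infinity>k\<in>(UNIV :: int set). Gamma (real_of_int \<bar>j + k * (2 * int N + 1)\<bar> - s) /
          Gamma (real_of_int \<bar>j + k * (2 * int N + 1)\<bar> + 1 + s)))"
proof -
  have h: "0 < h" using assms(3) by (simp add: divide_pos_pos add_nonneg_pos)
  note s = assms(1,2)
  show ?thesis
    using torus_kernel_eq(1)[OF s] torus_frac_laplacian_eq_kernel_sum[OF s h]
      torus_frac_laplacian_1d[OF s h] torus_kernel_1d[OF s h]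
    by (intro conjI allI ballI impI) 
qed

end
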